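(* Assume that $D=(d_{ij})$ is a constant matrix with $d_{ii}\ge0$, $d_{ij}\le0$ for $i\neq j$, $\sum_{j=1}^md_{ij}=0$ for all $i$, and $D$ irreducible, and assume (H0)–(H2). Then there exists at least one solution $(c,v)\in\mathbb R^m\times C(\mathbb T^N;\mathbb R^m)$ of the ergodic system $$H_i(x,Dv_i)+\sum_{j=1}^m d_{ij}v_j=c_i\quad\text{in }\mathbb T^N,\ 1\le i\le m,$$ with $v$ Lipschitz continuous and $c\in\ker D$; such a $c\in\ker D$ is unique and has the form $c=(c_1,\dots,c_1)$, and $$\sum_{i=1}^m\Lambda_i\min_{\mathbb T^N}f_i\le-c_1\sum_{i=1}^m\Lambda_i\le\min_{\mathbb T^N}\sum_{i=1}^m\Lambda_if_i,$$ where $\Lambda\in\mathbb R^m$, $\Lambda>0$, is any vector with $D^T\Lambda=0$.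
   Context: $\mathbb T^N=\mathbb R^N/\mathbb Z^N$. Irreducible: for every proper subset $\mathcal I\subsetneq\{1,\dots,m\}$ there exist $i\in\mathcal I$, $j\notin\mathcal I$ with $d_{ij}\ne0$. $H_i(x,p)=F_i(x,p)-f_i(x)$ with (H0) $f_i,F_i$ continuous, $1$-periodic in $x$; (H1) $F_i(x,\cdot)$ convex, coercive ($\inf_xF_i(x,p)\to\infty$ as $|p|\to\infty$), $F_i(x,p)\ge F_i(x,0)=0$; (H2) $f_i\ge0$. Viscosity solutions of systems are understood componentwise. (Under these hypotheses a vector $\Lambda>0$ with $D^T\Lambda=0$ exists.) *)

theory Defs
  imports "HOL-Analysis.Analysis"
begin

text \<open>Points of the torus T^N = R^N / Z^N are represented by points of R^N (type real^'n);
functions on the torus are 1-periodic functions on R^N.\<close>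

definition int_vec :: "real^'n \<Rightarrow> bool" where
  "int_vec k \<longleftrightarrow> (\<forall>j. k $ j \<in> \<int>)"

definition periodic1 :: "(real^'n \<Rightarrow> 'b) \<Rightarrow> bool" where
  "periodic1 u \<longleftrightarrow> (\<forall>x k. int_vec k \<longrightarrow> u (x + k) = u x)"

definition irreducible_mat :: "real^'m^'m \<Rightarrow> bool" where
  "irreducible_mat D \<longleftrightarrow>
     (\<forall>I. I \<noteq> {} \<and> I \<noteq> UNIV \<longrightarrow> (\<exists>i\<in>I. \<exists>j. j \<notin> I \<and> D $ i $ j \<noteq> 0))"

definition C1_with_grad :: "(real^'n \<Rightarrow> real) \<Rightarrow> (real^'n \<Rightarrow> real^'n) \<Rightarrow> bool" where
  "C1_with_grad \<phi> \<phi>' \<longleftrightarrow> continuous_on UNIV \<phi>' \<and>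
     (\<forall>x. (\<phi> has_derivative (\<lambda>h. \<phi>' x \<bullet> h)) (at x))"

definition loc_max_at :: "(real^'n \<Rightarrow> real) \<Rightarrow> real^'n \<Rightarrow> bool" where
  "loc_max_at w x0 \<longleftrightarrow> (\<exists>e>0. \<forall>y. dist y x0 < e \<longrightarrow> w y \<le> w x0)"

definition loc_min_at :: "(real^'n \<Rightarrow> real) \<Rightarrow> real^'n \<Rightarrow> bool" where
  "loc_min_at w x0 \<longleftrightarrow> (\<exists>e>0. \<forall>y. dist y x0 < e \<longrightarrow> w x0 \<le> w y)"

text \<open>(c,v) is a (continuous, periodic) viscosity solution of the ergodic system
  F_i(x,Dv_i) - f_i(x) + sum_j d_ij v_j = c_i in T^N, understood componentwise:
  the i-th equation is tested only on v_i, the other components entering as data.\<close>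

definition ergodic_visc_sol ::
  "('m \<Rightarrow> real^'n \<Rightarrow> real^'n \<Rightarrow> real) \<Rightarrow> ('m \<Rightarrow> real^'n \<Rightarrow> real) \<Rightarrow> real^'m^'m
   \<Rightarrow> real^'m \<Rightarrow> (real^'n \<Rightarrow> real^'m) \<Rightarrow> bool" where
  "ergodic_visc_sol F f D c v \<longleftrightarrow>
     continuous_on UNIV v \<and> periodic1 v \<and>
     (\<forall>i \<phi> \<phi>' x0. C1_with_grad \<phi> \<phi>' \<longrightarrow>
        (loc_max_at (\<lambda>y. v y $ i - \<phi> y) x0 \<longrightarrow>
           F i x0 (\<phi>' x0) - f i x0 + (\<Sum>j\<in>UNIV. D $ i $ j * v x0 $ j) \<le> c $ i) \<and>
        (loc_min_at (\<lambda>y. v y $ i - \<phi> y) x0 \<longrightarrow>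
           F i x0 (\<phi>' x0) - f i x0 + (\<Sum>j\<in>UNIV. D $ i $ j * v x0 $ j) \<ge> c $ i))"

end

theory Submission
  imports Defs "HOL-Complex_Analysis.Great_Picard"
begin

text \<open>Vanishing discount. For \<open>l > 0\<close> Perron's method yields a periodic solution of
  \<open>l u\<^sub>i + F\<^sub>i(x, Du\<^sub>i) - f\<^sub>i + (D u)\<^sub>i = 0\<close>. Since \<open>F \<ge> 0\<close>, every nonnegative subsolution satisfies
  \<open>l u + D u \<le> f\<close> pointwise, so by irreducibility its components differ by at most a
  constant independent of \<open>l\<close>; coercivity then gives a Lipschitz bound independent of \<open>l\<close>. Along a
  sequence \<open>l \<rightarrow> 0\<close> the solutions, normalised at the origin, converge uniformly to a solution of
  the ergodic system by the Arzela-Ascoli theorem and the stability of viscosity solutions.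
  Uniqueness of the constant is a comparison argument by doubling of variables. The lower bound
  comes from testing the \<open>i\<close>-th equation at a minimum of \<open>v\<^sub>i\<close>, the upper bound from \<open>F \<ge> 0\<close>, both
  after pairing with \<open>\<Lambda>\<close>, which annihilates the coupling.\<close>

text \<open>The obstacle is the coupling: a discounted solution is a priori only of size
  \<open>A / l\<close>, so \<open>D u\<close> could blow up as \<open>l\<close> tends to 0 and spoil
  the coercivity argument. Only differences of components enter, since the rows of \<open>D\<close>
  sum to zero, and these are controlled before any gradient bound. The estimates hold for every
  member of the class over which Perron's supremum is taken, so the supremum is Lipschitz from the
  start and can be inserted into the definition of a solution directly. Subtracting one and the same
  number from all components leaves the coupling unchanged, which is why the limit produces the same
  constant in every equation, hence a vector in the kernel of \<open>D\<close>.\<close>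

definition visc_sub ::
  "(real^'n \<Rightarrow> real^'n \<Rightarrow> real) \<Rightarrow> (real^'n \<Rightarrow> real) \<Rightarrow> (real^'n \<Rightarrow> real) \<Rightarrow> bool" where
  "visc_sub G g u \<longleftrightarrow>
     (\<forall>\<phi> \<phi>' x. C1_with_grad \<phi> \<phi>' \<longrightarrow> loc_max_at (\<lambda>y. u y - \<phi> y) x \<longrightarrow> G x (\<phi>' x) \<le> g x)"

definition visc_super ::
  "(real^'n \<Rightarrow> real^'n \<Rightarrow> real) \<Rightarrow> (real^'n \<Rightarrow> real) \<Rightarrow> (real^'n \<Rightarrow> real) \<Rightarrow> bool" where
  "visc_super G g u \<longleftrightarrow>
     (\<forall>\<phi> \<phi>' x. C1_with_grad \<phi> \<phi>' \<longrightarrow> loc_min_at (\<lambda>y. u y - \<phi> y) x \<longrightarrow> g x \<le> G x (\<phi>' x))"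

text \<open>The coupling is moved into the right-hand side and frozen there as a function of
  \<open>x\<close>, so each equation becomes a scalar one and the scalar lemmas apply
  componentwise.\<close>

lemma ergodic_visc_sol_iff:
  "ergodic_visc_sol F f D c v \<longleftrightarrow>
     continuous_on UNIV v \<and> periodic1 v \<and>
     (\<forall>i. visc_sub (F i) (\<lambda>x. c $ i + f i x - (D *v v x) $ i) (\<lambda>x. v x $ i) \<and>
          visc_super (F i) (\<lambda>x. c $ i + f i x - (D *v v x) $ i) (\<lambda>x. v x $ i))"
  unfolding ergodic_visc_sol_def visc_sub_def visc_super_def matrix_vector_mult_def
  by (simp add: algebra_simps) blast

subsection \<open>Test functions\<close>

lemma C1_with_grad_const: "C1_with_grad (\<lambda>_. a) (\<lambda>_. 0)"
  unfolding C1_with_grad_def by (auto intro!: derivative_eq_intros)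

lemma C1_with_grad_uminus:
  "C1_with_grad \<phi> \<phi>' \<Longrightarrow> C1_with_grad (\<lambda>y. - \<phi> y) (\<lambda>y. - \<phi>' y)"
  unfolding C1_with_grad_def by (auto intro!: continuous_intros derivative_eq_intros)

lemma C1_with_grad_diff:
  "C1_with_grad \<phi> \<phi>' \<Longrightarrow> C1_with_grad \<psi> \<psi>' \<Longrightarrow>
     C1_with_grad (\<lambda>y. \<phi> y - \<psi> y) (\<lambda>y. \<phi>' y - \<psi>' y)"
  unfolding C1_with_grad_def
  by (auto intro!: continuous_intros derivative_eq_intros simp: inner_diff_left)

lemma C1_with_grad_add_quadratic:
  assumes "C1_with_grad \<phi> \<phi>'"
  shows "C1_with_grad (\<lambda>y. \<phi> y + a * (dist y z)\<^sup>2) (\<lambda>y. \<phi>' y + (2 * a) *\<^sub>R (y - z))"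
  using assms unfolding C1_with_grad_def dist_norm power2_norm_eq_inner
  by (auto intro!: continuous_intros derivative_eq_intros
      simp: inner_add_left inner_commute algebra_simps)

lemma C1_with_grad_quadratic:
  "C1_with_grad (\<lambda>y. c + a * (dist y z)\<^sup>2) (\<lambda>y. (2 * a) *\<^sub>R (y - z))"
  using C1_with_grad_add_quadratic[OF C1_with_grad_const] by simp

lemma C1_with_grad_continuous: "C1_with_grad \<phi> \<phi>' \<Longrightarrow> continuous_on UNIV \<phi>"
  unfolding C1_with_grad_def
  by (meson continuous_at_imp_continuous_on has_derivative_continuous)

lemma C1_with_grad_grad_continuous: "C1_with_grad \<phi> \<phi>' \<Longrightarrow> continuous_on UNIV \<phi>'"
  by (simp add: C1_with_grad_def)

lemma C1_with_grad_loc_max: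
  assumes "C1_with_grad \<phi> \<phi>'" "loc_max_at \<phi> x"
  shows "\<phi>' x = 0"
proof -
  obtain e where e: "e > 0" "\<And>y. dist y x < e \<Longrightarrow> \<phi> y \<le> \<phi> x"
    using assms(2) by (auto simp: loc_max_at_def)
  have der: "(\<phi> has_derivative (\<lambda>h. \<phi>' x \<bullet> h)) (at x within ball x e)"
    using assms(1) unfolding C1_with_grad_def by (meson has_derivative_at_withinI)
  have "(\<lambda>h. \<phi>' x \<bullet> h) = (\<lambda>v. 0)"
    by (rule differential_zero_maxmin[OF _ _ has_derivative_at_withinI, of x "ball x e" \<phi>])
       (use e assms(1) in \<open>auto simp: C1_with_grad_def dist_commute\<close>)
  then show ?thesis by (metis inner_eq_zero_iff)
qed

text \<open>A maximum over the closed ball exists by compactness; strictness on the sphere forces it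
  inside, where it is a local maximum.\<close>

lemma interior_loc_max:
  fixes u \<phi> :: "real^'n \<Rightarrow> real"
  assumes "continuous_on UNIV u" "continuous_on UNIV \<phi>" "t > 0"
    and less: "\<And>y. dist y x = t \<Longrightarrow> u y - \<phi> y < u x - \<phi> x"
  obtains y where "dist y x < t" "loc_max_at (\<lambda>y. u y - \<phi> y) y"
proof -
  have "continuous_on (cball x t) (\<lambda>y. u y - \<phi> y)"
    using assms(1,2) by (auto intro!: continuous_intros elim: continuous_on_subset)
  with \<open>t > 0\<close> obtain y where y: "y \<in> cball x t"
      "\<And>z. z \<in> cball x t \<Longrightarrow> u z - \<phi> z \<le> u y - \<phi> y"
    using continuous_attains_sup[OF compact_cball, of x t "\<lambda>y. u y - \<phi> y"] by auto
  from y(2)[of x] less[of y] y(1) \<open>t > 0\<close> have yt: "dist y x < t"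
    by (force simp: dist_commute)
  have "dist z x < t" if "dist z y < t - dist y x" for z
    using dist_triangle[of z x y] that by simp
  then have "loc_max_at (\<lambda>y. u y - \<phi> y) y"
    unfolding loc_max_at_def using yt y(2)
    by (intro exI[of _ "t - dist y x"]) (auto simp: dist_commute less_imp_le)
  with yt that show ?thesis by blast
qed

subsection \<open>Scalar viscosity sub- and supersolutions\<close>

text \<open>Negating \<open>u\<close> and the test function swaps maxima and minima. Results that
  ask only for continuity of \<open>G\<close>, such as stability, thereby transfer to
  supersolutions.\<close>

lemma visc_super_iff_sub:
  "visc_super G g u \<longleftrightarrow> visc_sub (\<lambda>x p. - G x (- p)) (\<lambda>x. - g x) (\<lambda>x. - u x)"
proof
  assume super: "visc_super G g u"
  show "visc_sub (\<lambda>x p. - G x (- p)) (\<lambda>x. - g x) (\<lambda>x. - u x)"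
    unfolding visc_sub_def
  proof (intro allI impI)
    fix \<phi> \<phi>' x assume "C1_with_grad \<phi> \<phi>'" "loc_max_at (\<lambda>y. - u y - \<phi> y) x"
    then have "C1_with_grad (\<lambda>y. - \<phi> y) (\<lambda>y. - \<phi>' y)" "loc_min_at (\<lambda>y. u y - - \<phi> y) x"
      by (auto simp: loc_min_at_def loc_max_at_def intro: C1_with_grad_uminus) force
    with super show "- G x (- \<phi>' x) \<le> - g x"
      unfolding visc_super_def by fastforce
  qed
next
  assume sub: "visc_sub (\<lambda>x p. - G x (- p)) (\<lambda>x. - g x) (\<lambda>x. - u x)"
  show "visc_super G g u"
    unfolding visc_super_def
  proof (intro allI impI)
    fix \<phi> \<phi>' x assume "C1_with_grad \<phi> \<phi>'" "loc_min_at (\<lambda>y. u y - \<phi> y) x"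
    then have "C1_with_grad (\<lambda>y. - \<phi> y) (\<lambda>y. - \<phi>' y)" "loc_max_at (\<lambda>y. - u y - - \<phi> y) x"
      by (auto simp: loc_min_at_def loc_max_at_def intro: C1_with_grad_uminus) force
    with sub show "g x \<le> G x (\<phi>' x)"
      unfolding visc_sub_def by fastforce
  qed
qed

lemma visc_sub_mono:
  "visc_sub G g u \<Longrightarrow> (\<And>x. g x \<le> h x) \<Longrightarrow> visc_sub G h u"
  unfolding visc_sub_def by (meson order_trans)

lemma visc_sub_add_const: "visc_sub G g (\<lambda>x. u x - a) \<longleftrightarrow> visc_sub G g u"
  unfolding visc_sub_def loc_max_at_def by simp

lemma visc_super_add_const: "visc_super G g (\<lambda>x. u x - a) \<longleftrightarrow> visc_super G g u"
  unfolding visc_super_def loc_min_at_def by simp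

lemma visc_sub_translate:
  assumes "visc_sub G g u" "\<And>x p. G (x + k) p = G x p"
  shows "visc_sub G (\<lambda>x. g (x + k)) (\<lambda>x. u (x + k))"
  unfolding visc_sub_def
proof (intro allI impI)
  fix \<phi> \<phi>' x assume C1: "C1_with_grad \<phi> \<phi>'" and lm: "loc_max_at (\<lambda>y. u (y + k) - \<phi> y) x"
  have "C1_with_grad (\<lambda>y. \<phi> (y - k)) (\<lambda>y. \<phi>' (y - k))"
    unfolding C1_with_grad_def
  proof (intro conjI allI)
    show "continuous_on UNIV (\<lambda>y. \<phi>' (y - k))"
      by (rule continuous_on_compose2[OF C1_with_grad_grad_continuous[OF C1]])
         (auto intro!: continuous_intros)
    have "(\<phi> has_derivative (\<lambda>h. \<phi>' (y - k) \<bullet> h)) (at (y - k))" for y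
      using C1 by (simp add: C1_with_grad_def)
    from has_derivative_compose[of "\<lambda>y. y - k" "\<lambda>h. h", OF _ this]
    show "((\<lambda>y. \<phi> (y - k)) has_derivative (\<lambda>h. \<phi>' (y - k) \<bullet> h)) (at y)" for y
      by (simp add: has_derivative_diff[OF has_derivative_ident has_derivative_const, simplified])
  qed
  moreover have "loc_max_at (\<lambda>y. u y - \<phi> (y - k)) (x + k)"
  proof -
    obtain e where e: "e > 0" "\<And>y. dist y x < e \<Longrightarrow> u (y + k) - \<phi> y \<le> u (x + k) - \<phi> x"
      using lm by (auto simp: loc_max_at_def)
    have "u y - \<phi> (y - k) \<le> u (x + k) - \<phi> x" if "dist y (x + k) < e" for y
      using e(2)[of "y - k"] that by (simp add: dist_norm algebra_simps)
    with e(1) show ?thesis by (auto simp: loc_max_at_def)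
  qed
  ultimately have "G (x + k) (\<phi>' (x + k - k)) \<le> g (x + k)"
    using assms(1) unfolding visc_sub_def by blast
  then show "G x (\<phi>' x) \<le> g (x + k)" by (simp add: assms(2))
qed

lemma continuous_on_pos_nbhd:
  fixes E :: "real^'n \<Rightarrow> real"
  assumes "continuous_on UNIV E" "a < E x"
  obtains s where "s > 0" "\<And>y. dist y x < s \<Longrightarrow> a < E y"
proof -
  have "open {y. a < E y}"
    by (intro open_Collect_less continuous_intros assms(1))
  then show ?thesis using assms(2) that by (force simp: open_dist)
qed

text \<open>Subsolutions are stable under one-sided limits, of the kind satisfied both by suprema and
  by uniform limits: adding the quadratic makes the maximum strict, so it survives a perturbation.\<close>

lemma visc_sub_stable:
  fixes w :: "real^'n \<Rightarrow> real"
  assumes contG: "continuous_on UNIV (\<lambda>z. G (fst z) (snd z))"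
    and contg: "continuous_on UNIV g"
    and approx: "\<And>x \<epsilon>. \<epsilon> > 0 \<Longrightarrow> \<exists>r>0. \<forall>\<delta>>0. \<exists>u h. visc_sub G h u \<and> continuous_on UNIV u \<and>
          (\<forall>y. dist y x \<le> r \<longrightarrow> h y \<le> g y + \<epsilon> \<and> u y \<le> w y + \<delta>) \<and> w x - \<delta> \<le> u x"
  shows "visc_sub G g w"
  unfolding visc_sub_def
proof (intro allI impI)
  fix \<phi> \<phi>' x assume C1: "C1_with_grad \<phi> \<phi>'" and lm: "loc_max_at (\<lambda>y. w y - \<phi> y) x"
  show "G x (\<phi>' x) \<le> g x"
  proof (rule ccontr)
    assume contra: "\<not> ?thesis"
    \<comment> \<open>Half of the gap: near \<open>x\<close> more than \<open>\<epsilon>\<close> of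
      it survives by continuity, while the perturbed right-hand side uses up at most
      \<open>\<epsilon>\<close>.\<close>
    define \<epsilon> where "\<epsilon> = (G x (\<phi>' x) - g x) / 2"
    define \<psi>' where "\<psi>' = (\<lambda>y. \<phi>' y + (2 * 1) *\<^sub>R (y - x))"
    have C1\<psi>: "C1_with_grad (\<lambda>y. \<phi> y + 1 * (dist y x)\<^sup>2) \<psi>'"
      unfolding \<psi>'_def by (rule C1_with_grad_add_quadratic[OF C1])
    have "\<epsilon> > 0" using contra by (simp add: \<epsilon>_def)
    have "continuous_on UNIV (\<lambda>y. G y (\<psi>' y) - g y)"
      by (intro continuous_on_diff contg
          continuous_on_compose2[OF contG, of _ "\<lambda>y. (y, \<psi>' y)", simplified]
          continuous_on_Pair continuous_on_id C1_with_grad_grad_continuous[OF C1\<psi>])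
    moreover have "\<epsilon> < G x (\<psi>' x) - g x"
      using contra by (simp add: \<epsilon>_def \<psi>'_def field_simps)
    ultimately obtain s where s: "s > 0" "\<And>y. dist y x < s \<Longrightarrow> \<epsilon> < G y (\<psi>' y) - g y"
      using continuous_on_pos_nbhd[of "\<lambda>y. G y (\<psi>' y) - g y"] by blast
    obtain e where e: "e > 0" "\<And>y. dist y x < e \<Longrightarrow> w y - \<phi> y \<le> w x - \<phi> x"
      using lm by (auto simp: loc_max_at_def)
    obtain r where r: "r > 0" "\<And>\<delta>. \<delta> > 0 \<Longrightarrow> \<exists>u h. visc_sub G h u \<and> continuous_on UNIV u \<and>
          (\<forall>y. dist y x \<le> r \<longrightarrow> h y \<le> g y + \<epsilon> \<and> u y \<le> w y + \<delta>) \<and> w x - \<delta> \<le> u x"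
      using approx[OF \<open>\<epsilon> > 0\<close>, of x] by blast
    define t where "t = min (s / 2) (min (e / 2) r)"
    have t: "t > 0" "t < s" "t < e" "t \<le> r"
      using s(1) e(1) r(1) by (auto simp: t_def)
    \<comment> \<open>The tolerance depends on \<open>t\<close>, which is at most \<open>r\<close>;
      hence \<open>r\<close> precedes \<open>\<delta>\<close> in the hypothesis. Two errors of
      \<open>t\<^sup>2 / 4\<close> stay below \<open>t\<^sup>2\<close>, the value of the quadratic
      on the sphere.\<close>
    obtain u h where u: "visc_sub G h u" "continuous_on UNIV u"
        "\<And>y. dist y x \<le> r \<Longrightarrow> h y \<le> g y + \<epsilon>" "\<And>y. dist y x \<le> r \<Longrightarrow> u y \<le> w y + t\<^sup>2 / 4"
        "w x - t\<^sup>2 / 4 \<le> u x"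
      using r(2)[of "t\<^sup>2 / 4"] t(1) by auto
    have t2: "t\<^sup>2 > 0" using t(1) by simp
    have less: "u y - (\<phi> y + 1 * (dist y x)\<^sup>2) < u x - (\<phi> x + 1 * (dist x x)\<^sup>2)"
      if "dist y x = t" for y
    proof -
      have "w y - \<phi> y \<le> w x - \<phi> x" "u y \<le> w y + t\<^sup>2 / 4"
        using e(2) u(4) t that by auto
      with u(5) t2 show ?thesis unfolding that dist_self power2_eq_square[of 0] by linarith
    qed
    obtain y where y: "dist y x < t" "loc_max_at (\<lambda>y. u y - (\<phi> y + 1 * (dist y x)\<^sup>2)) y"
      using interior_loc_max[OF u(2) C1_with_grad_continuous[OF C1\<psi>] t(1) less] by blast
    have "G y (\<psi>' y) \<le> h y"
      using u(1) C1\<psi> y(2) unfolding visc_sub_def by blast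
    with u(3)[of y] s(2)[of y] y(1) t show False by simp
  qed
qed

lemma visc_sub_uniform_limit:
  fixes w :: "real^'n \<Rightarrow> real"
  assumes contG: "continuous_on UNIV (\<lambda>z. G (fst z) (snd z))"
    and contg: "continuous_on UNIV g"
    and u: "uniform_limit UNIV u w sequentially" and h: "uniform_limit UNIV h g sequentially"
    and sub: "\<And>n. visc_sub G (h n) (u n)" and cont: "\<And>n. continuous_on UNIV (u n)"
  shows "visc_sub G g w"
proof (rule visc_sub_stable[OF contG contg])
  fix x :: "real^'n" and \<epsilon> :: real assume "\<epsilon> > 0"
  have "\<exists>u h. visc_sub G h u \<and> continuous_on UNIV u \<and>
      (\<forall>y. dist y x \<le> 1 \<longrightarrow> h y \<le> g y + \<epsilon> \<and> u y \<le> w y + \<delta>) \<and> w x - \<delta> \<le> u x"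
    if "\<delta> > 0" for \<delta>
  proof -
    have "\<forall>\<^sub>F n in sequentially. (\<forall>y\<in>UNIV. dist (u n y) (w y) < \<delta>) \<and> (\<forall>y\<in>UNIV. dist (h n y) (g y) < \<epsilon>)"
      using uniform_limitD[OF u that] uniform_limitD[OF h \<open>\<epsilon> > 0\<close>] by (rule eventually_conj)
    then obtain n where n: "\<And>y. dist (u n y) (w y) < \<delta>" "\<And>y. dist (h n y) (g y) < \<epsilon>"
      by (auto simp: eventually_sequentially)
    have "h n y \<le> g y + \<epsilon>" "u n y \<le> w y + \<delta>" "w y - \<delta> \<le> u n y" for y
      using n(1)[of y] n(2)[of y] by (auto simp: dist_real_def)
    with sub cont show ?thesis by blast
  qed
  then show "\<exists>r>0. \<forall>\<delta>>0. \<exists>u h. visc_sub G h u \<and> continuous_on UNIV u \<and>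
      (\<forall>y. dist y x \<le> r \<longrightarrow> h y \<le> g y + \<epsilon> \<and> u y \<le> w y + \<delta>) \<and> w x - \<delta> \<le> u x"
    by (intro exI[of _ 1]) auto
qed

lemma visc_super_uniform_limit:
  fixes w :: "real^'n \<Rightarrow> real"
  assumes contG: "continuous_on UNIV (\<lambda>z. G (fst z) (snd z))"
    and contg: "continuous_on UNIV g"
    and u: "uniform_limit UNIV u w sequentially" and h: "uniform_limit UNIV h g sequentially"
    and super: "\<And>n. visc_super G (h n) (u n)" and cont: "\<And>n. continuous_on UNIV (u n)"
  shows "visc_super G g w"
  unfolding visc_super_iff_sub
proof (rule visc_sub_uniform_limit)
  show "continuous_on UNIV (\<lambda>z. - G (fst z) (- snd z))"
    by (intro continuous_on_minus
        continuous_on_compose2[OF contG, of _ "\<lambda>z. (fst z, - snd z)", simplified] continuous_intros)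
  show "visc_sub (\<lambda>x p. - G x (- p)) (\<lambda>x. - h n x) (\<lambda>x. - u n x)" for n
    using super unfolding visc_super_iff_sub by blast
qed (auto intro!: continuous_intros uniform_limit_intros contg u h cont)

text \<open>The conclusion holds at every \<open>x\<close> because the points at which a continuous function is touched
  from above by a quadratic are dense.\<close>

lemma visc_sub_rhs_nonneg:
  fixes u :: "real^'n \<Rightarrow> real"
  assumes "visc_sub G g u" "continuous_on UNIV u" "continuous_on UNIV g" "\<And>x p. 0 \<le> G x p"
  shows "0 \<le> g x"
proof (rule ccontr)
  assume "\<not> ?thesis"
  moreover have "continuous_on UNIV (\<lambda>y. - g y)"
    using assms(3) by (intro continuous_intros)
  ultimately obtain s where s: "s > 0" "\<And>y. dist y x < s \<Longrightarrow> 0 < - g y"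
    using continuous_on_pos_nbhd[of "\<lambda>y. - g y" 0 x] by auto
  have "bounded (u ` cball x s)"
    by (intro compact_imp_bounded compact_continuous_image continuous_on_subset[OF assms(2)]) auto
  then obtain B where B: "\<And>y. y \<in> cball x s \<Longrightarrow> \<bar>u y\<bar> \<le> B"
    unfolding bounded_real by blast
  have B0: "\<bar>u x\<bar> \<le> B" using B s(1) by simp
  \<comment> \<open>On the sphere of radius \<open>s\<close> the penalty equals
    \<open>2 * B + 1\<close>, more than the oscillation of \<open>u\<close> on the ball.\<close>
  define N where "N = (2 * B + 1) / s\<^sup>2"
  have C1: "C1_with_grad (\<lambda>y. N * (dist y x)\<^sup>2) (\<lambda>y. (2 * N) *\<^sub>R (y - x))"
    using C1_with_grad_quadratic[of 0] by simp
  have less: "u y - N * (dist y x)\<^sup>2 < u x - N * (dist x x)\<^sup>2" if "dist y x = s" for y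
  proof -
    have "N * (dist y x)\<^sup>2 = 2 * B + 1" using that s(1) by (simp add: N_def)
    moreover have "\<bar>u y\<bar> \<le> B" using B[of y] that by (simp add: dist_commute)
    ultimately show ?thesis using B0 by (simp only: dist_self) simp
  qed
  obtain y where y: "dist y x < s" "loc_max_at (\<lambda>y. u y - N * (dist y x)\<^sup>2) y"
    using interior_loc_max[OF assms(2) C1_with_grad_continuous[OF C1] s(1) less] by blast
  have "G y ((2 * N) *\<^sub>R (y - x)) \<le> g y"
    using assms(1) C1 y(2) unfolding visc_sub_def by blast
  with assms(4)[of y "(2 * N) *\<^sub>R (y - x)"] s(2)[OF y(1)] show False by simp
qed

text \<open>The cone \<open>K |y - x|\<close> lies below the quadratic \<open>K (|y - x|\<^sup>2 + s\<^sup>2) / (2 s)\<close>, which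
  touches it on the sphere of radius \<open>s\<close> and is a smooth test function.\<close>

lemma visc_sub_lipschitz:
  fixes u :: "real^'n \<Rightarrow> real"
  assumes sub: "visc_sub G g u" and cont: "continuous_on UNIV u" and bdd: "\<And>x. \<bar>u x\<bar> \<le> M"
    and g: "\<And>x. g x \<le> K" and G: "\<And>x p. norm p \<ge> R \<Longrightarrow> K < G x p" and R: "R > 0"
  shows "R-lipschitz_on UNIV u"
proof -
  have cone: "u y - u x \<le> R * dist y x" for x y
  proof -
    have M: "M \<ge> 0" using bdd[of x] by linarith
    \<comment> \<open>Outside this radius the cone exceeds \<open>2 * M + 1\<close>, so the maximum
      over the ball is global.\<close>
    define \<rho> where "\<rho> = (2 * M + 1) / R"
    have \<rho>: "\<rho> > 0" using M R by (simp add: \<rho>_def)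
    have "continuous_on (cball x \<rho>) (\<lambda>y. u y - R * dist y x)"
      by (intro continuous_intros continuous_on_subset[OF cont]) auto
    then obtain z where z: "z \<in> cball x \<rho>"
        "\<And>y. y \<in> cball x \<rho> \<Longrightarrow> u y - R * dist y x \<le> u z - R * dist z x"
      using continuous_attains_sup[OF compact_cball, of x \<rho> "\<lambda>y. u y - R * dist y x"] \<rho> by auto
    have zmax: "u y - R * dist y x \<le> u z - R * dist z x" for y
    proof (cases "y \<in> cball x \<rho>")
      case False
      then have "R * dist y x > 2 * M + 1"
        using R by (simp add: \<rho>_def dist_commute field_simps)
      then have "u y - R * dist y x \<le> u x"
        using bdd[of y] bdd[of x] by (simp add: abs_le_iff)
      also have "\<dots> \<le> u z - R * dist z x" using z(2)[of x] \<rho> by simp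
      finally show ?thesis .
    qed (use z in auto)
    \<comment> \<open>A maximum away from the apex would yield a test gradient of norm exactly
      \<open>R\<close>, where \<open>G\<close> exceeds \<open>K\<close>. A maximum at the apex is
      the one-sided Lipschitz estimate.\<close>
    have "z = x"
    proof (rule ccontr)
      assume "z \<noteq> x"
      define s where "s = dist z x"
      have s: "s > 0" using \<open>z \<noteq> x\<close> by (simp add: s_def)
      define a where "a = R / (2 * s)"
      have C1: "C1_with_grad (\<lambda>y. R * s / 2 + a * (dist y x)\<^sup>2) (\<lambda>y. (2 * a) *\<^sub>R (y - x))"
        by (rule C1_with_grad_quadratic)
      have above: "R * d \<le> R * s / 2 + a * d\<^sup>2" for d
      proof -
        have "R * s / 2 + a * d\<^sup>2 - R * d = a * (d - s)\<^sup>2"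
          using s by (simp add: a_def field_simps power2_eq_square)
        also have "\<dots> \<ge> 0" using R s by (simp add: a_def)
        finally show ?thesis by simp
      qed
      have "R * s / 2 + a * (dist z x)\<^sup>2 = R * dist z x"
        using s by (simp add: a_def s_def[symmetric] field_simps power2_eq_square)
      then have "loc_max_at (\<lambda>y. u y - (R * s / 2 + a * (dist y x)\<^sup>2)) z"
        unfolding loc_max_at_def using zmax above
        by (intro exI[of _ 1]) (smt (verit))
      with C1 sub have "G z ((2 * a) *\<^sub>R (z - x)) \<le> g z"
        unfolding visc_sub_def by blast
      moreover have "norm ((2 * a) *\<^sub>R (z - x)) = R"
        using s R by (simp add: a_def s_def dist_norm)
      ultimately show False using G[of "(2 * a) *\<^sub>R (z - x)" z] g[of z] by simp
    qed
    with zmax[of y] show ?thesis by simp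
  qed
  show ?thesis
  proof (rule lipschitz_onI)
    fix x y show "dist (u x) (u y) \<le> R * dist x y"
      using cone[of x y] cone[of y x] by (simp add: dist_real_def dist_commute abs_le_iff)
  qed (use R in simp)
qed

lemma loc_max_at_le:
  "loc_max_at (\<lambda>y. v y - \<phi> y) x \<Longrightarrow> (\<And>y. u y \<le> v y) \<Longrightarrow> u x = v x \<Longrightarrow> loc_max_at (\<lambda>y. u y - \<phi> y) x"
  unfolding loc_max_at_def by (smt (verit, best))

lemma lipschitz_on_components:
  fixes u :: "'a::metric_space \<Rightarrow> real^'m"
  assumes "\<And>i. L-lipschitz_on S (\<lambda>x. u x $ i)"
  shows "(real CARD('m) * L)-lipschitz_on S u"
proof (rule lipschitz_onI)
  fix x y assume xy: "x \<in> S" "y \<in> S"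
  have "dist (u x) (u y) \<le> (\<Sum>i\<in>UNIV. \<bar>(u x - u y) $ i\<bar>)"
    unfolding dist_norm by (rule norm_le_l1_cart)
  also have "\<dots> \<le> (\<Sum>i\<in>(UNIV::'m set). L * dist x y)"
    using lipschitz_onD[OF assms xy] by (intro sum_mono) (simp add: dist_real_def)
  finally show "dist (u x) (u y) \<le> real CARD('m) * L * dist x y" by simp
qed (use lipschitz_on_nonneg[OF assms] in simp)

subsection \<open>Periodic functions\<close>

lemma periodic_translate_unit_cube:
  obtains k :: "real^'n" where "int_vec k" "x + k \<in> cbox 0 1"
proof
  show "int_vec (- (\<chi> j. of_int \<lfloor>x $ j\<rfloor>) :: real^'n)" by (simp add: int_vec_def)
  show "x + - (\<chi> j. of_int \<lfloor>x $ j\<rfloor>) \<in> cbox 0 1"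
    by (auto simp: mem_box_cart) linarith+
qed

lemma periodic_bounded:
  fixes u :: "real^'n \<Rightarrow> 'b::real_normed_vector"
  assumes "continuous_on UNIV u" "periodic1 u"
  obtains B where "\<And>x. norm (u x) \<le> B"
proof -
  have "bounded (u ` cbox 0 1)"
    by (intro compact_imp_bounded compact_continuous_image continuous_on_subset[OF assms(1)]) auto
  then obtain B where B: "\<And>x. x \<in> cbox 0 1 \<Longrightarrow> norm (u x) \<le> B"
    unfolding bounded_iff by blast
  have "norm (u x) \<le> B" for x
  proof -
    obtain k where "int_vec k" "x + k \<in> cbox 0 1" by (rule periodic_translate_unit_cube)
    with B[of "x + k"] assms(2) show ?thesis by (simp add: periodic1_def)
  qed
  with that show ?thesis by blast
qed

lemma periodic_attains_inf:
  fixes u :: "real^'n \<Rightarrow> real"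
  assumes "continuous_on UNIV u" "periodic1 u"
  obtains x where "\<And>y. u x \<le> u y"
proof -
  have "continuous_on (cbox 0 1) u" using assms(1) continuous_on_subset by blast
  moreover have "cbox 0 (1::real^'n) \<noteq> {}" using periodic_translate_unit_cube[of 0] by auto
  ultimately obtain x where x: "\<And>y. y \<in> cbox 0 1 \<Longrightarrow> u x \<le> u y"
    using continuous_attains_inf[OF compact_cbox, of 0 1 u] by auto
  have "u x \<le> u y" for y
  proof -
    obtain k where "int_vec k" "y + k \<in> cbox 0 1" by (rule periodic_translate_unit_cube)
    with x[of "y + k"] assms(2) show ?thesis by (simp add: periodic1_def)
  qed
  with that show ?thesis by blast
qed

subsection \<open>Coupling matrices\<close>

lemma largest_component:
  fixes z :: "real^'m"
  obtains k where "\<And>j. z $ j \<le> z $ k"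
proof -
  have "Max (range (($) z)) \<in> range (($) z)" by (intro Max_in) auto
  then obtain k where k: "Max (range (($) z)) = z $ k" by (rule imageE)
  have "z $ j \<le> z $ k" for j unfolding k[symmetric] by (rule Max_ge) auto
  with that show ?thesis by blast
qed

locale coupling_matrix =
  fixes D :: "real^'m^'m"
  assumes D_off: "\<And>i j. i \<noteq> j \<Longrightarrow> D $ i $ j \<le> 0"
    and D_rows: "\<And>i. (\<Sum>j\<in>UNIV. D $ i $ j) = 0"
    and D_irr: "irreducible_mat D"
begin

text \<open>Zero row sums allow \<open>z $ i\<close> to be subtracted from every component; the
  diagonal term then vanishes and only coefficients of known sign remain.\<close>

lemma mult_component_diff: "(D *v z) $ i = (\<Sum>j\<in>UNIV. D $ i $ j * (z $ j - z $ i))"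
  using D_rows[of i]
  by (simp add: matrix_vector_mult_def right_diff_distrib sum_subtractf flip: sum_distrib_right)

lemma mult_const: "D *v (\<chi> i. a) = 0"
  by (simp add: vec_eq_iff mult_component_diff)

lemma mult_shift: "D *v (z - (\<chi> i. a)) = D *v z"
  by (simp add: matrix_vector_mult_diff_distrib mult_const)

text \<open>Where \<open>z - y\<close> has its largest component, the differences
  \<open>z $ j - z $ i\<close> are at most those of \<open>y\<close>, and the nonpositive
  off-diagonal coefficients reverse this. It is the maximum principle for the coupling.\<close>

lemma mult_mono_at:
  assumes "\<And>j. z $ j - y $ j \<le> z $ i - y $ i"
  shows "(D *v y) $ i \<le> (D *v z) $ i"
proof -
  have "D $ i $ j * (y $ j - y $ i) \<le> D $ i $ j * (z $ j - z $ i)" for j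
  proof (cases "j = i")
    case False
    then show ?thesis
      using D_off[of i j] assms[of j] by (intro mult_left_mono_neg) auto
  qed simp
  then show ?thesis unfolding mult_component_diff by (intro sum_mono) auto
qed

text \<open>The off-diagonal terms are nonpositive and are dropped. Applied to a difference of
  ordered vectors, it bounds the change of the \<open>i\<close>-th coupling term by the
  \<open>i\<close>-th gap alone.\<close>

lemma mult_le_diag:
  assumes "\<And>j. 0 \<le> z $ j"
  shows "(D *v z) $ i \<le> D $ i $ i * z $ i"
proof -
  have "(D *v z) $ i = D $ i $ i * z $ i + (\<Sum>j\<in>UNIV - {i}. D $ i $ j * z $ j)"
    by (simp add: matrix_vector_mult_def sum.remove)
  moreover have "(\<Sum>j\<in>UNIV - {i}. D $ i $ j * z $ j) \<le> 0"
    using D_off assms by (intro sum_nonpos mult_nonpos_nonneg) auto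
  ultimately show ?thesis by simp
qed

lemma diag_nonneg: "0 \<le> D $ i $ i"
proof -
  have "(\<Sum>j\<in>UNIV. D $ i $ j) = D $ i $ i + (\<Sum>j\<in>UNIV - {i}. D $ i $ j)"
    by (simp add: sum.remove)
  moreover have "(\<Sum>j\<in>UNIV - {i}. D $ i $ j) \<le> 0" using D_off by (intro sum_nonpos) auto
  ultimately show ?thesis using D_rows by simp
qed

text \<open>Starting from the largest component, an upper bound on \<open>D z\<close> carries a lower bound on
  \<open>z $ i\<close> over to \<open>z $ j\<close> whenever \<open>D $ i $ j \<noteq> 0\<close>; irreducibility reaches every component.\<close>

lemma oscillation_bound:
  "\<exists>C\<ge>0. \<forall>z A. 0 \<le> A \<longrightarrow> (\<forall>i. (D *v z) $ i \<le> A) \<longrightarrow> (\<forall>i j. z $ j - z $ i \<le> C * A)"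
proof -
  \<comment> \<open>Induction on the size of a set \<open>I\<close> of indices whose components lie
    within \<open>C * A\<close> of the largest one. The set may depend on \<open>z\<close>, the
    constant may not.\<close>
  have "\<exists>C\<ge>0. \<forall>z A. 0 \<le> A \<longrightarrow> (\<forall>i. (D *v z) $ i \<le> A) \<longrightarrow>
          (\<exists>I. Suc k \<le> card I \<and> (\<forall>i\<in>I. \<forall>j. z $ j - z $ i \<le> C * A))"
    if "Suc k \<le> CARD('m)" for k
    using that
  proof (induction k)
    case 0
    have "\<exists>I. Suc 0 \<le> card I \<and> (\<forall>i\<in>I. \<forall>j. z $ j - z $ i \<le> 0 * A)" for z :: "real^'m" and A
    proof -
      obtain i where "\<And>j. z $ j \<le> z $ i" by (rule largest_component[of z]) blast
      then show ?thesis by (intro exI[of _ "{i}"]) auto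
    qed
    then show ?case by (intro exI[of _ 0]) auto
  next
    case (Suc k)
    then obtain C where C: "C \<ge> 0" and ex: "\<And>z A. 0 \<le> A \<Longrightarrow> (\<And>i. (D *v z) $ i \<le> A) \<Longrightarrow>
          \<exists>I. Suc k \<le> card I \<and> (\<forall>i\<in>I. \<forall>j. z $ j - z $ i \<le> C * A)"
      by auto
    define B where "B = (\<Sum>i\<in>UNIV. \<Sum>j\<in>UNIV. \<bar>D $ i $ j\<bar>)"
    \<comment> \<open>A common bound for the reciprocals of the nonzero entries; zero entries
      contribute \<open>1 / 0 = 0\<close>.\<close>
    define E where "E = (\<Sum>i\<in>UNIV. \<Sum>j\<in>UNIV. 1 / \<bar>D $ i $ j\<bar>)"
    have B: "(\<Sum>j\<in>UNIV. \<bar>D $ i $ j\<bar>) \<le> B" for i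
      unfolding B_def by (intro member_le_sum) (auto intro: sum_nonneg)
    have E: "1 / \<bar>D $ i $ j\<bar> \<le> E" for i j
    proof -
      have "1 / \<bar>D $ i $ j\<bar> \<le> (\<Sum>j\<in>UNIV. 1 / \<bar>D $ i $ j\<bar>)"
        by (intro member_le_sum) auto
      also have "\<dots> \<le> E"
        unfolding E_def by (intro member_le_sum) (auto intro: sum_nonneg)
      finally show ?thesis .
    qed
    have BE: "B \<ge> 0" "E \<ge> 0" unfolding B_def E_def by (auto intro!: sum_nonneg)
    \<comment> \<open>Isolating the \<open>j\<close>-th summand of \<open>(D *v z) $ i\<close> gives
      \<open>z $ i - z $ j \<le> (1 + B * C) * E * A\<close>; the extra \<open>C\<close> is the
      distance of \<open>z $ i\<close> from the largest component.\<close>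
    define C' where "C' = C + (1 + B * C) * E"
    have "\<exists>I. Suc (Suc k) \<le> card I \<and> (\<forall>i\<in>I. \<forall>j. z $ j - z $ i \<le> C' * A)"
      if A: "0 \<le> A" and z: "\<And>i. (D *v z) $ i \<le> A" for z A
    proof -
      obtain I where I: "Suc k \<le> card I" "\<And>i j. i \<in> I \<Longrightarrow> z $ j - z $ i \<le> C * A"
        using ex[OF A z] by auto
      have CC': "C * A \<le> C' * A" using BE C A by (intro mult_right_mono) (auto simp: C'_def)
      show ?thesis
      proof (cases "I = UNIV")
        case True
        with Suc.prems I CC' show ?thesis by (intro exI[of _ UNIV]) (auto intro: order_trans)
      next
        case False
        moreover have "I \<noteq> {}" using I(1) by auto
        ultimately obtain i j where ij: "i \<in> I" "j \<notin> I" "D $ i $ j \<noteq> 0"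
          using D_irr unfolding irreducible_mat_def by metis
        have neg: "D $ i $ j < 0" using D_off[of i j] ij by force
        have "z $ l - z $ j \<le> C' * A" for l
        proof -
          have "- (D $ i $ l * (z $ l - z $ i)) \<le> \<bar>D $ i $ l\<bar> * (C * A)" for l
          proof (cases "l = i")
            case False
            then have "- D $ i $ l * (z $ l - z $ i) \<le> - D $ i $ l * (C * A)"
              using D_off[of i l] I(2)[OF ij(1), of l] by (intro mult_left_mono) auto
            then show ?thesis using D_off[of i l] False by simp
          qed (use A C in simp)
          then have "(\<Sum>l\<in>UNIV - {j}. - (D $ i $ l * (z $ l - z $ i))) \<le>
              (\<Sum>l\<in>UNIV - {j}. \<bar>D $ i $ l\<bar> * (C * A))"
            by (intro sum_mono) auto
          also have "\<dots> \<le> (\<Sum>l\<in>UNIV. \<bar>D $ i $ l\<bar> * (C * A))"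
            using A C by (intro sum_mono2) auto
          also have "\<dots> = (\<Sum>l\<in>UNIV. \<bar>D $ i $ l\<bar>) * (C * A)"
            by (simp add: sum_distrib_right)
          also have "\<dots> \<le> B * (C * A)"
            using B A C by (intro mult_right_mono) auto
          finally have rest: "(\<Sum>l\<in>UNIV - {j}. - (D $ i $ l * (z $ l - z $ i))) \<le> B * (C * A)" .
          have "(D *v z) $ i = D $ i $ j * (z $ j - z $ i)
              + (\<Sum>l\<in>UNIV - {j}. D $ i $ l * (z $ l - z $ i))"
            unfolding mult_component_diff by (simp add: sum.remove)
          with z[of i] rest have "D $ i $ j * (z $ j - z $ i) \<le> A + B * (C * A)"
            unfolding sum_negf by linarith
          then have "\<bar>D $ i $ j\<bar> * (z $ i - z $ j) \<le> A + B * (C * A)"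
            using neg by (simp add: algebra_simps)
          then have "z $ i - z $ j \<le> (A + B * (C * A)) * (1 / \<bar>D $ i $ j\<bar>)"
            using neg by (simp add: field_simps)
          also have "\<dots> \<le> (A + B * (C * A)) * E"
            using E BE C A by (intro mult_left_mono) auto
          finally show ?thesis
            using I(2)[OF ij(1), of l] by (simp add: C'_def algebra_simps)
        qed
        moreover have "z $ l - z $ h \<le> C' * A" if "h \<in> I" for l h
          using I(2)[OF that, of l] CC' by linarith
        ultimately show ?thesis
          using I(1) ij(2) by (intro exI[of _ "insert j I"]) auto
      qed
    qed
    moreover have "C' \<ge> 0" using C BE by (simp add: C'_def)
    ultimately show ?case by blast
  qed
  from this[of "CARD('m) - 1"] obtain C where "C \<ge> 0" and
    C: "\<And>z A. 0 \<le> A \<Longrightarrow> (\<And>i. (D *v z) $ i \<le> A) \<Longrightarrow>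
          \<exists>I. CARD('m) \<le> card I \<and> (\<forall>i\<in>I. \<forall>j. z $ j - z $ i \<le> C * A)"
    by auto
  have "I = UNIV" if "CARD('m) \<le> card I" for I :: "'m set"
    using that by (intro card_seteq) auto
  with C \<open>C \<ge> 0\<close> show ?thesis by (intro exI[of _ C]) (metis UNIV_I)
qed

text \<open>The oscillation bound with \<open>A = 0\<close> leaves no room for a difference between
  components.\<close>

lemma kernel_const:
  assumes "D *v c = 0"
  shows "c $ i = c $ j"
proof -
  obtain C where "\<forall>z A. 0 \<le> A \<longrightarrow> (\<forall>i. (D *v z) $ i \<le> A) \<longrightarrow> (\<forall>i j. z $ j - z $ i \<le> C * A)"
    using oscillation_bound by blast
  from this[rule_format, of 0 c] assms have "\<And>i j. c $ j - c $ i \<le> 0" by simp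
  then show ?thesis by (meson antisym diff_le_0_iff_le)
qed

end

subsection \<open>Perron's method for the discounted system\<close>

locale weakly_coupled = coupling_matrix D
  for D :: "real^'m^'m" +
  fixes F :: "'m \<Rightarrow> real^'n \<Rightarrow> real^'n \<Rightarrow> real"
    and f :: "'m \<Rightarrow> real^'n \<Rightarrow> real"
  assumes F_cont: "\<And>i. continuous_on UNIV (\<lambda>z. F i (fst z) (snd z))"
    and f_cont: "\<And>i. continuous_on UNIV (f i)"
    and F_per: "\<And>i p. periodic1 (\<lambda>x. F i x p)"
    and f_per: "\<And>i. periodic1 (f i)"
    and F_coercive: "\<And>i M. \<exists>R. \<forall>x p. norm p \<ge> R \<longrightarrow> F i x p \<ge> M"
    and F_zero: "\<And>i x. F i x 0 = 0"
    and F_nonneg: "\<And>i x p. F i x p \<ge> 0"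
    and f_nonneg: "\<And>i x. f i x \<ge> 0"
begin

lemma F_continuous_comp:
  assumes "continuous_on S g" "continuous_on S h"
  shows "continuous_on S (\<lambda>x. F i (g x) (h x))"
  using continuous_on_compose2[OF F_cont[of i] continuous_on_Pair[OF assms]] by simp

lemma f_bounded: obtains A where "A \<ge> 0" "\<And>i x. f i x \<le> A"
proof -
  have "\<exists>B. \<forall>x. norm (f i x) \<le> B" for i
    using periodic_bounded[OF f_cont f_per] by metis
  then obtain B where B: "\<And>i x. norm (f i x) \<le> B i" by metis
  have "f i x \<le> (\<Sum>i\<in>UNIV. \<bar>B i\<bar>)" for i x
  proof -
    have "f i x \<le> \<bar>B i\<bar>" using B[of i x] by simp
    also have "\<dots> \<le> (\<Sum>i\<in>UNIV. \<bar>B i\<bar>)" by (intro member_le_sum) auto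
    finally show ?thesis .
  qed
  then show ?thesis using that[of "\<Sum>i\<in>UNIV. \<bar>B i\<bar>"] by (simp add: sum_nonneg)
qed

lemma F_coercive_uniform:
  obtains R where "R > 0" "\<And>i x p. norm p \<ge> R \<Longrightarrow> K < F i x p"
proof -
  obtain R where R: "\<And>i x p. norm p \<ge> R i \<Longrightarrow> F i x p \<ge> K + 1"
    using F_coercive[where M = "K + 1"] by metis
  have "K < F i x p" if "norm p \<ge> 1 + (\<Sum>i\<in>UNIV. \<bar>R i\<bar>)" for i x p
  proof -
    have "R i \<le> \<bar>R i\<bar>" by simp
    also have "\<dots> \<le> (\<Sum>i\<in>UNIV. \<bar>R i\<bar>)" by (intro member_le_sum) auto
    finally show ?thesis using R[of i p x] that by simp
  qed
  moreover have "1 + (\<Sum>i\<in>UNIV. \<bar>R i\<bar>) > 0" by (smt (verit) sum_nonneg abs_ge_zero)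
  ultimately show ?thesis using that by blast
qed

text \<open>Periodicity is left out on purpose: it keeps the bump construction in
  \<open>perron_solution\<close> local, and the largest subsolution is periodic by translation invariance.\<close>

definition subsols :: "real \<Rightarrow> (real^'n \<Rightarrow> real^'m) set" where
  "subsols l = {u. continuous_on UNIV u \<and> (\<forall>x i. 0 \<le> u x $ i) \<and>
     (\<forall>i. visc_sub (F i) (\<lambda>x. f i x - l * u x $ i - (D *v u x) $ i) (\<lambda>x. u x $ i))}"

lemma rhs_continuous:
  assumes "continuous_on UNIV u"
  shows "continuous_on UNIV (\<lambda>x. a + f i x - l * u x $ i - (D *v u x) $ i)"
  unfolding matrix_vector_mult_def
  by (auto intro!: continuous_intros assms f_cont)

section \<open>A priori estimates for discounted subsolutions\<close>

lemma subsols_pointwise: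
  assumes "u \<in> subsols l"
  shows "l * u x $ i + (D *v u x) $ i \<le> f i x"
proof -
  have "0 \<le> f i x - l * u x $ i - (D *v u x) $ i"
  proof (rule visc_sub_rhs_nonneg[where G = "F i"])
    show "visc_sub (F i) (\<lambda>x. f i x - l * u x $ i - (D *v u x) $ i) (\<lambda>x. u x $ i)"
      using assms by (simp add: subsols_def)
    show "continuous_on UNIV (\<lambda>x. u x $ i)"
      using assms by (auto simp: subsols_def intro!: continuous_intros)
    show "continuous_on UNIV (\<lambda>x. f i x - l * u x $ i - (D *v u x) $ i)"
      using rhs_continuous[of u 0 i l] assms by (simp add: subsols_def)
  qed (rule F_nonneg)
  then show ?thesis by simp
qed

text \<open>At the largest component of \<open>u x\<close> the coupling term is nonnegative, so the
  pointwise inequality bounds the discount term there.\<close>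

lemma subsols_bound:
  assumes "u \<in> subsols l" "l > 0" "\<And>i x. f i x \<le> A"
  shows "l * u x $ i \<le> A"
proof -
  obtain k where k: "\<And>j. u x $ j \<le> u x $ k" by (rule largest_component[of "u x"]) blast
  have "(D *v 0) $ k \<le> (D *v u x) $ k" by (rule mult_mono_at) (simp add: k)
  then have "l * u x $ k \<le> A"
    using subsols_pointwise[OF assms(1), of x k] assms(3)[of k x] by simp
  moreover have "l * u x $ i \<le> l * u x $ k" using k assms(2) by simp
  ultimately show ?thesis by linarith
qed

lemma subsols_oscillation:
  "\<exists>C\<ge>0. \<forall>l>0. \<forall>u\<in>subsols l. \<forall>x i j. u x $ j - u x $ i \<le> C"
proof -
  obtain A where A: "A \<ge> 0" "\<And>i x. f i x \<le> A" by (rule f_bounded) blast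
  obtain C where C: "C \<ge> 0"
    "\<forall>z A. 0 \<le> A \<longrightarrow> (\<forall>i. (D *v z) $ i \<le> A) \<longrightarrow> (\<forall>i j. z $ j - z $ i \<le> C * A)"
    using oscillation_bound by blast
  have "u x $ j - u x $ i \<le> C * A" if "l > 0" "u \<in> subsols l" for l u x i j
  proof (rule C(2)[rule_format, OF A(1)])
    fix k
    have "0 \<le> l * u x $ k" using that by (simp add: subsols_def)
    then show "(D *v u x) $ k \<le> A"
      using subsols_pointwise[OF that(2), of x k] A(2)[of k x] by linarith
  qed
  with A(1) C(1) show ?thesis by (intro exI[of _ "C * A"]) auto
qed

lemma subsols_lipschitz:
  "\<exists>L>0. \<forall>l>0. \<forall>u\<in>subsols l. \<forall>i. L-lipschitz_on UNIV (\<lambda>x. u x $ i)"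
proof -
  obtain A where A: "A \<ge> 0" "\<And>i x. f i x \<le> A" by (rule f_bounded) blast
  obtain C where C: "C \<ge> 0" "\<And>l u x i j. l > 0 \<Longrightarrow> u \<in> subsols l \<Longrightarrow> u x $ j - u x $ i \<le> C"
    using subsols_oscillation by blast
  define B where "B = (\<Sum>i\<in>UNIV. D $ i $ i)"
  have B: "D $ i $ i \<le> B" for i
    unfolding B_def by (rule member_le_sum) (auto simp: diag_nonneg)
  obtain R where R: "R > 0" "\<And>i x p. norm p \<ge> R \<Longrightarrow> A + B * C < F i x p"
    by (rule F_coercive_uniform) blast
  have "R-lipschitz_on UNIV (\<lambda>x. u x $ i)" if l: "l > 0" and u: "u \<in> subsols l" for l u i
  \<comment> \<open>The bound \<open>A / l\<close> degenerates as \<open>l\<close> tends to 0, but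
    the Lipschitz constant depends only on \<open>K\<close>, which is free of
    \<open>l\<close>.\<close>
  proof (rule visc_sub_lipschitz[where M = "A / l" and K = "A + B * C" and G = "F i" and
        g = "\<lambda>x. f i x - l * u x $ i - (D *v u x) $ i"])
    fix x
    show "\<bar>u x $ i\<bar> \<le> A / l"
      using subsols_bound[OF u l A(2), of x i] u l
      by (auto simp: subsols_def field_simps)
    have "- (D *v u x) $ i \<le> B * C"
    proof -
      \<comment> \<open>Constants lie in the kernel, so \<open>D *v y\<close> is the negative of
        \<open>D *v u x\<close>; moreover \<open>y\<close> is nonnegative with
        \<open>y $ i = C\<close>, as \<open>mult_le_diag\<close> requires.\<close>
      define y where "y = (\<chi> j. C - (u x $ j - u x $ i))"
      have "(D *v y) $ i = - (D *v u x) $ i"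
        by (simp add: y_def mult_component_diff flip: sum_negf) (simp add: algebra_simps)
      moreover have "(D *v y) $ i \<le> D $ i $ i * y $ i"
        using C(2)[OF l u] by (intro mult_le_diag) (simp add: y_def)
      moreover have "D $ i $ i * y $ i \<le> B * C"
        using B C(1) by (simp add: y_def mult_right_mono)
      ultimately show ?thesis by simp
    qed
    moreover have "0 \<le> l * u x $ i" using u l by (simp add: subsols_def)
    ultimately show "f i x - l * u x $ i - (D *v u x) $ i \<le> A + B * C"
      using A(2)[of i x] by simp
  qed (use u R in \<open>auto simp: subsols_def intro!: continuous_intros\<close>)
  with R(1) show ?thesis by blast
qed

lemma subsols_zero: "(\<lambda>_. 0) \<in> subsols l"
proof -
  have "visc_sub (F i) (f i) (\<lambda>_. 0)" for i
    unfolding visc_sub_def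
  proof (intro allI impI)
    fix \<phi> \<phi>' and x :: "real^'n"
    assume C1: "C1_with_grad \<phi> \<phi>'" and lm: "loc_max_at (\<lambda>y. 0 - \<phi> y) x"
    have "- \<phi>' x = 0"
      using C1_with_grad_loc_max[OF C1_with_grad_uminus[OF C1]] lm by simp
    then show "F i x (\<phi>' x) \<le> f i x" by (simp add: F_zero f_nonneg)
  qed
  then show ?thesis by (simp add: subsols_def)
qed

lemma subsols_translate:
  assumes "u \<in> subsols l" "int_vec k"
  shows "(\<lambda>x. u (x + k)) \<in> subsols l"
proof -
  have "visc_sub (F i) (\<lambda>x. f i (x + k) - l * u (x + k) $ i - (D *v u (x + k)) $ i)
      (\<lambda>x. u (x + k) $ i)" for i
  proof (rule visc_sub_translate[where u = "\<lambda>x. u x $ i" and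
        g = "\<lambda>x. f i x - l * u x $ i - (D *v u x) $ i"])
    show "F i (x + k) p = F i x p" for x p
      using F_per[of i p] assms(2) by (simp add: periodic1_def)
  qed (use assms(1) in \<open>simp add: subsols_def\<close>)
  moreover have "f i (x + k) = f i x" for i x
    using f_per[of i] assms(2) by (simp add: periodic1_def)
  moreover have "continuous_on UNIV (\<lambda>x. u (x + k))"
    using assms(1) continuous_on_compose2[of UNIV u UNIV "\<lambda>x. x + k"]
    by (simp add: subsols_def continuous_on_add)
  ultimately show ?thesis using assms(1) by (simp add: subsols_def)
qed

section \<open>The maximal subsolution\<close>

definition max_subsol :: "real \<Rightarrow> real^'n \<Rightarrow> real^'m" where
  "max_subsol l x = (\<chi> i. SUP u\<in>subsols l. u x $ i)"

lemma max_subsol_bdd: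
  assumes "l > 0"
  shows "bdd_above ((\<lambda>u. u x $ i) ` subsols l)"
proof -
  obtain A where A: "A \<ge> 0" "\<And>i x. f i x \<le> A" by (rule f_bounded) blast
  have "u x $ i \<le> A / l" if "u \<in> subsols l" for u
    using subsols_bound[OF that assms A(2), of x i] assms by (simp add: field_simps)
  then show ?thesis by (auto intro!: bdd_aboveI)
qed

lemma max_subsol_upper: "l > 0 \<Longrightarrow> u \<in> subsols l \<Longrightarrow> u x $ i \<le> max_subsol l x $ i"
  by (auto simp: max_subsol_def intro!: cSUP_upper max_subsol_bdd)

lemma max_subsol_least:
  "(\<And>u. u \<in> subsols l \<Longrightarrow> u x $ i \<le> b) \<Longrightarrow> max_subsol l x $ i \<le> b"
  using subsols_zero[of l] by (auto simp: max_subsol_def intro!: cSUP_least)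

lemma max_subsol_approx:
  assumes "l > 0" "\<delta> > 0"
  obtains u where "u \<in> subsols l" "max_subsol l x $ i - \<delta> \<le> u x $ i"
proof -
  have "\<exists>u\<in>subsols l. max_subsol l x $ i - \<delta> < u x $ i"
    using assms subsols_zero[of l] less_cSUP_iff[OF _ max_subsol_bdd[of l x i], of "max_subsol l x $ i - \<delta>"]
    by (auto simp: max_subsol_def)
  with that show ?thesis by (meson less_imp_le)
qed

lemma max_subsol_periodic:
  assumes "l > 0"
  shows "periodic1 (max_subsol l)"
proof -
  have le: "max_subsol l (x + k) $ i \<le> max_subsol l x $ i" if k: "int_vec k" for x k i
  proof (rule max_subsol_least)
    fix u assume "u \<in> subsols l"
    from max_subsol_upper[OF assms subsols_translate[OF this k]]
    show "u (x + k) $ i \<le> max_subsol l x $ i" by simp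
  qed
  have "max_subsol l x $ i \<le> max_subsol l (x + k) $ i" if k: "int_vec k" for x k i
    using le[of "- k" "x + k" i] k by (simp add: int_vec_def)
  with le show ?thesis unfolding periodic1_def vec_eq_iff by (meson antisym)
qed

lemma max_subsol_lipschitz:
  assumes "l > 0" "\<And>u. u \<in> subsols l \<Longrightarrow> L-lipschitz_on UNIV (\<lambda>x. u x $ i)"
  shows "L-lipschitz_on UNIV (\<lambda>x. max_subsol l x $ i)"
proof -
  have le: "max_subsol l x $ i \<le> max_subsol l y $ i + L * dist x y" for x y
  proof (rule max_subsol_least)
    fix u assume u: "u \<in> subsols l"
    have "u x $ i \<le> u y $ i + L * dist x y"
      using lipschitz_onD[OF assms(2)[OF u], of x y] by (simp add: dist_real_def)
    with max_subsol_upper[OF assms(1) u, of y i]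
    show "u x $ i \<le> max_subsol l y $ i + L * dist x y" by linarith
  qed
  show ?thesis
  proof (rule lipschitz_onI)
    show "dist (max_subsol l x $ i) (max_subsol l y $ i) \<le> L * dist x y" for x y
      using le[of x y] le[of y x] by (simp add: dist_real_def dist_commute abs_le_iff)
    show "0 \<le> L" using assms(2)[OF subsols_zero] lipschitz_on_nonneg by blast
  qed
qed

text \<open>A subsolution close to the supremum in component \<open>i\<close> may be far below it in
  the others. By the sign of \<open>D\<close> this only lowers its \<open>i\<close>-th right-hand
  side, so approximating one component at a time suffices for stability.\<close>

lemma max_subsol_in_subsols:
  assumes l: "l > 0"
  shows "max_subsol l \<in> subsols l"
proof -
  let ?w = "max_subsol l"
  obtain L where L: "L > 0" "\<And>u i. u \<in> subsols l \<Longrightarrow> L-lipschitz_on UNIV (\<lambda>x. u x $ i)"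
    using subsols_lipschitz l by blast
  have Lw: "L-lipschitz_on UNIV (\<lambda>x. ?w x $ i)" for i
    by (rule max_subsol_lipschitz[OF l L(2)])
  have cont: "continuous_on UNIV ?w"
  proof -
    have "continuous_on UNIV (\<lambda>x. \<chi> i. ?w x $ i)"
      by (intro continuous_on_vec_lambda lipschitz_on_continuous_on[OF Lw])
    then show ?thesis by simp
  qed
  have "visc_sub (F i) (\<lambda>x. f i x - l * ?w x $ i - (D *v ?w x) $ i) (\<lambda>x. ?w x $ i)" for i
  proof (rule visc_sub_stable[OF F_cont])
    show "continuous_on UNIV (\<lambda>x. f i x - l * ?w x $ i - (D *v ?w x) $ i)"
      using rhs_continuous[OF cont, of 0 i l] by simp
    fix x :: "real^'n" and \<epsilon> :: real assume "\<epsilon> > 0"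
    define \<kappa> where "\<kappa> = l + D $ i $ i"
    have \<kappa>: "\<kappa> > 0" using l diag_nonneg[of i] by (simp add: \<kappa>_def)
    \<comment> \<open>The gap in component \<open>i\<close> is at most
      \<open>\<epsilon> / (2 * \<kappa>)\<close> at \<open>x\<close> and grows by at most
      \<open>2 * (L * r)\<close>, the same amount, within the ball; the factor
      \<open>\<kappa>\<close> turns the sum into \<open>\<epsilon>\<close>.\<close>
    define r where "r = \<epsilon> / (4 * L * \<kappa>)"
    have "r > 0" using \<open>\<epsilon> > 0\<close> L(1) \<kappa> by (simp add: r_def)
    have "\<exists>u h. visc_sub (F i) h u \<and> continuous_on UNIV u \<and>
        (\<forall>y. dist y x \<le> r \<longrightarrow> h y \<le> f i y - l * ?w y $ i - (D *v ?w y) $ i + \<epsilon> \<and>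
            u y \<le> ?w y $ i + \<delta>) \<and> ?w x $ i - \<delta> \<le> u x" if "\<delta> > 0" for \<delta>
    proof -
      have "min \<delta> (\<epsilon> / (2 * \<kappa>)) > 0" using that \<open>\<epsilon> > 0\<close> \<kappa> by simp
      then obtain u where u: "u \<in> subsols l" "?w x $ i - min \<delta> (\<epsilon> / (2 * \<kappa>)) \<le> u x $ i"
        by (rule max_subsol_approx[OF l])
      have "f i y - l * u y $ i - (D *v u y) $ i \<le> f i y - l * ?w y $ i - (D *v ?w y) $ i + \<epsilon>"
        if y: "dist y x \<le> r" for y
      proof -
        have "(D *v (?w y - u y)) $ i \<le> D $ i $ i * (?w y - u y) $ i"
          by (rule mult_le_diag) (simp add: max_subsol_upper[OF l u(1)])
        then have "l * ?w y $ i + (D *v ?w y) $ i - l * u y $ i - (D *v u y) $ i \<le>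
            \<kappa> * (?w y $ i - u y $ i)"
          by (simp add: matrix_vector_mult_diff_distrib \<kappa>_def algebra_simps)
        also have "\<dots> \<le> \<kappa> * (\<epsilon> / (2 * \<kappa>) + 2 * (L * r))"
        proof (rule mult_left_mono)
          have "L * dist y x \<le> L * r" using y L(1) by simp
          moreover have "?w y $ i \<le> ?w x $ i + L * dist y x" "u x $ i \<le> u y $ i + L * dist y x"
            using lipschitz_onD[OF Lw, of y x i] lipschitz_onD[OF L(2)[OF u(1)], of y x i]
            by (auto simp: dist_real_def abs_le_iff)
          ultimately show "?w y $ i - u y $ i \<le> \<epsilon> / (2 * \<kappa>) + 2 * (L * r)"
            using u(2) by simp
        qed (use \<kappa> in simp)
        also have "\<dots> = \<epsilon>" using \<kappa> L(1) by (simp add: r_def field_simps)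
        finally show ?thesis by simp
      qed
      moreover have "continuous_on UNIV (\<lambda>y. u y $ i)"
        by (rule lipschitz_on_continuous_on[OF L(2)[OF u(1)]])
      moreover have "u y $ i \<le> ?w y $ i + \<delta>" for y
        using max_subsol_upper[OF l u(1), of y i] \<open>\<delta> > 0\<close> by simp
      ultimately show ?thesis
        using u by (intro exI[of _ "\<lambda>y. u y $ i"]
            exI[of _ "\<lambda>y. f i y - l * u y $ i - (D *v u y) $ i"]) (auto simp: subsols_def)
    qed
    with \<open>r > 0\<close> show "\<exists>r>0. \<forall>\<delta>>0. \<exists>u h. visc_sub (F i) h u \<and> continuous_on UNIV u \<and>
        (\<forall>y. dist y x \<le> r \<longrightarrow> h y \<le> f i y - l * ?w y $ i - (D *v ?w y) $ i + \<epsilon> \<and>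
            u y \<le> ?w y $ i + \<delta>) \<and> ?w x $ i - \<delta> \<le> u x"
      by blast
  qed
  moreover have "0 \<le> ?w x $ i" for x i
    using max_subsol_upper[OF l subsols_zero, where x = x and i = i] by simp
  ultimately show ?thesis using cont by (simp add: subsols_def)
qed

text \<open>If the maximal subsolution failed to be a supersolution in the \<open>i\<close>-th equation, its \<open>i\<close>-th
  component could be raised locally; by the sign of the off-diagonal entries of \<open>D\<close> the other
  equations only benefit from this.\<close>

lemma perron_solution:
  assumes l: "l > 0"
  shows "visc_super (F i) (\<lambda>x. f i x - l * max_subsol l x $ i - (D *v max_subsol l x) $ i)
           (\<lambda>x. max_subsol l x $ i)"
  unfolding visc_super_def
proof (intro allI impI)
  let ?w = "max_subsol l"
  fix \<phi> \<phi>' x assume C1: "C1_with_grad \<phi> \<phi>'" and lm: "loc_min_at (\<lambda>y. ?w y $ i - \<phi> y) x"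
  have w: "?w \<in> subsols l" by (rule max_subsol_in_subsols[OF l])
  then have w_cont: "continuous_on UNIV ?w"
    and w_sub: "\<And>j. visc_sub (F j) (\<lambda>x. f j x - l * ?w x $ j - (D *v ?w x) $ j) (\<lambda>x. ?w x $ j)"
    by (auto simp: subsols_def)
  show "f i x - l * ?w x $ i - (D *v ?w x) $ i \<le> F i x (\<phi>' x)"
  proof (rule ccontr)
    assume contra: "\<not> ?thesis"
    \<comment> \<open>The test function shifted to touch component \<open>i\<close> at
      \<open>x\<close> from below; the quadratic makes the contact strict.\<close>
    define \<psi>\<^sub>0 where "\<psi>\<^sub>0 y = ?w x $ i + \<phi> y - \<phi> x - (dist y x)\<^sup>2" for y
    define \<psi>' where "\<psi>' y = \<phi>' y + (2 * -1) *\<^sub>R (y - x)" for y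
    define \<kappa> where "\<kappa> = l + D $ i $ i"
    have \<kappa>: "\<kappa> > 0" using l diag_nonneg[of i] by (simp add: \<kappa>_def)
    have C1\<psi>: "C1_with_grad (\<lambda>y. \<phi> y + -1 * (dist y x)\<^sup>2) \<psi>'"
      unfolding \<psi>'_def by (rule C1_with_grad_add_quadratic[OF C1])
    \<comment> \<open>The slack in the \<open>i\<close>-th subsolution inequality when component
      \<open>i\<close> is replaced by \<open>\<psi>\<^sub>0\<close>; a failing supersolution test
      makes it positive at \<open>x\<close>.\<close>
    define E where "E y = f i y - l * ?w y $ i - (D *v ?w y) $ i
        - \<kappa> * (\<psi>\<^sub>0 y - ?w y $ i) - F i y (\<psi>' y)" for y
    have "continuous_on UNIV (\<lambda>y. F i y (\<psi>' y))"
      by (intro F_continuous_comp continuous_on_id C1_with_grad_grad_continuous[OF C1\<psi>])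
    moreover have "continuous_on UNIV (\<lambda>y. \<kappa> * (\<psi>\<^sub>0 y - ?w y $ i))"
      unfolding \<psi>\<^sub>0_def by (intro continuous_intros w_cont C1_with_grad_continuous[OF C1])
    ultimately have "continuous_on UNIV E"
      unfolding E_def using rhs_continuous[OF w_cont, of 0 i l]
      by (intro continuous_on_diff[of UNIV "\<lambda>y. _ y - \<kappa> * _ y"]
          continuous_on_diff[of UNIV "\<lambda>y. f i y - _ y - _ y"]) simp_all
    moreover define \<eta> where "\<eta> = E x / 2"
    have Ex: "E x > 0" using contra by (simp add: E_def \<psi>\<^sub>0_def \<psi>'_def)
    then have "\<eta> < E x" by (simp add: \<eta>_def)
    ultimately obtain s where s: "s > 0" "\<And>y. dist y x < s \<Longrightarrow> \<eta> < E y"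
      using continuous_on_pos_nbhd[of E] by blast
    obtain e where e: "e > 0" "\<And>y. dist y x < e \<Longrightarrow> ?w x $ i - \<phi> x \<le> ?w y $ i - \<phi> y"
      using lm by (auto simp: loc_min_at_def)
    define r where "r = min s e"
    have r: "r > 0" "r \<le> s" "r \<le> e" using s(1) e(1) by (auto simp: r_def)
    \<comment> \<open>The first bound hides the raised function below the old one beyond radius
      \<open>r / 2\<close>, which makes the gluing continuous; the second keeps the cost
      \<open>\<kappa> * \<delta>\<close> of raising within the slack.\<close>
    define \<delta> where "\<delta> = min ((r / 2)\<^sup>2) (\<eta> / \<kappa>)"
    have "\<eta> > 0" using Ex by (simp add: \<eta>_def)
    have \<delta>: "\<delta> > 0" "\<delta> \<le> (r / 2)\<^sup>2" "\<kappa> * \<delta> \<le> \<eta>"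
      using r(1) \<open>\<eta> > 0\<close> \<kappa> by (auto simp: \<delta>_def min_def field_simps)
    define b where "b y = (if dist y x < r then max (?w y $ i) (\<psi>\<^sub>0 y + \<delta>) else ?w y $ i)" for y
    define u where "u y = ?w y + (b y - ?w y $ i) *\<^sub>R axis i 1" for y
    have u_comp: "u y $ j = (if j = i then b y else ?w y $ j)" for y j
      by (simp add: u_def axis_def)
    have b_ge: "?w y $ i \<le> b y" for y by (simp add: b_def)
    have b_far: "b y = ?w y $ i" if "r / 2 < dist y x" for y
    proof (cases "dist y x < r")
      case True
      have "(r / 2)\<^sup>2 < (dist y x)\<^sup>2" using that r(1) by (intro power_strict_mono) auto
      then have "\<psi>\<^sub>0 y + \<delta> \<le> ?w y $ i"
        using e(2)[of y] True r(3) \<delta>(2) by (simp add: \<psi>\<^sub>0_def)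
      with True show ?thesis by (simp add: b_def)
    qed (simp add: b_def)
    have b_cont: "continuous_on UNIV b"
    proof -
      have "continuous_on (ball x r) b"
      proof (rule continuous_on_eq)
        show "continuous_on (ball x r) (\<lambda>y. max (?w y $ i) (\<psi>\<^sub>0 y + \<delta>))"
          unfolding \<psi>\<^sub>0_def
          by (rule continuous_on_subset[of UNIV])
            (auto intro!: continuous_intros w_cont C1_with_grad_continuous[OF C1])
      qed (simp add: b_def dist_commute)
      moreover have "continuous_on (- cball x (r / 2)) b"
        by (rule continuous_on_eq[of _ "\<lambda>y. ?w y $ i"])
          (auto intro!: continuous_intros continuous_on_subset[OF w_cont] simp: b_far dist_commute)
      moreover have "ball x r \<union> - cball x (r / 2) = UNIV" using r(1) by auto
      ultimately show ?thesis
        using continuous_on_open_Un[of "ball x r" "- cball x (r / 2)" b] by auto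
    qed
    have "continuous_on UNIV u"
      unfolding u_def by (intro continuous_intros w_cont b_cont)
    moreover have "0 \<le> u y $ j" for y j
    proof -
      have "0 \<le> ?w y $ j" for j using w by (simp add: subsols_def)
      then show ?thesis using b_ge[of y] by (auto simp: u_comp intro: order_trans)
    qed
    moreover have "visc_sub (F j) (\<lambda>y. f j y - l * u y $ j - (D *v u y) $ j) (\<lambda>y. u y $ j)" for j
    proof (cases "j = i")
      case False
      have "(D *v u y) $ j \<le> (D *v ?w y) $ j" for y
        using False b_ge[of y] by (intro mult_mono_at) (auto simp: u_comp)
      then show ?thesis
        using visc_sub_mono[OF w_sub[of j]] False by (simp add: u_comp)
    next
      case True
      have rhs: "f i y - l * u y $ i - (D *v u y) $ i =
          f i y - l * ?w y $ i - (D *v ?w y) $ i - \<kappa> * (b y - ?w y $ i)" for y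
      proof -
        have "(D *v u y) $ i = (D *v ?w y) $ i + (b y - ?w y $ i) * D $ i $ i"
          by (simp add: u_def matrix_vector_right_distrib matrix_vector_mult_basis
              matrix_vector_mult_scaleR column_def)
        then show ?thesis by (simp add: u_comp \<kappa>_def algebra_simps)
      qed
      have "visc_sub (F i) (\<lambda>y. f i y - l * u y $ i - (D *v u y) $ i) b"
        unfolding visc_sub_def
      proof (intro allI impI)
        fix \<Phi> \<Phi>' y assume C1\<Phi>: "C1_with_grad \<Phi> \<Phi>'" and lmb: "loc_max_at (\<lambda>z. b z - \<Phi> z) y"
        show "F i y (\<Phi>' y) \<le> f i y - l * u y $ i - (D *v u y) $ i"
        \<comment> \<open>Either the test function also touches the old component at
          \<open>y\<close>, or it touches the smooth \<open>\<psi>\<^sub>0 + \<delta>\<close>, and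
          then the two gradients agree.\<close>
        proof (cases "b y = ?w y $ i")
          case True
          have "loc_max_at (\<lambda>z. ?w z $ i - \<Phi> z) y"
            by (rule loc_max_at_le[OF lmb]) (simp_all add: b_ge True)
          then have "F i y (\<Phi>' y) \<le> f i y - l * ?w y $ i - (D *v ?w y) $ i"
            using w_sub C1\<Phi> unfolding visc_sub_def by blast
          then show ?thesis unfolding rhs by (simp add: True)
        next
          case False
          then have y: "dist y x < r" "b y = \<psi>\<^sub>0 y + \<delta>"
            by (auto simp: b_def max_def split: if_splits)
          obtain d where d: "d > 0" "\<And>z. dist z y < d \<Longrightarrow> b z - \<Phi> z \<le> b y - \<Phi> y"
            using lmb by (auto simp: loc_max_at_def)
          have "loc_max_at (\<lambda>z. \<phi> z + -1 * (dist z x)\<^sup>2 - \<Phi> z) y"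
            unfolding loc_max_at_def
          proof (intro exI conjI allI impI)
            show "min d (r - dist y x) > 0" using d(1) y(1) by simp
            fix z assume z: "dist z y < min d (r - dist y x)"
            then have "dist z x < r" using dist_triangle[of z x y] by simp
            then have "\<psi>\<^sub>0 z + \<delta> \<le> b z" by (simp add: b_def)
            then have "\<psi>\<^sub>0 z - \<Phi> z \<le> \<psi>\<^sub>0 y - \<Phi> y" using d(2)[of z] z y(2) by simp
            then show "\<phi> z + -1 * (dist z x)\<^sup>2 - \<Phi> z \<le> \<phi> y + -1 * (dist y x)\<^sup>2 - \<Phi> y"
              by (simp add: \<psi>\<^sub>0_def)
          qed
          then have "\<psi>' y - \<Phi>' y = 0"
            using C1_with_grad_loc_max[OF C1_with_grad_diff[OF C1\<psi> C1\<Phi>]] by simp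
          then have "F i y (\<Phi>' y) = F i y (\<psi>' y)" by simp
          moreover have "\<eta> < E y" using s(2) y(1) r(2) by simp
          ultimately show ?thesis
            unfolding rhs using \<delta>(3) by (simp add: E_def y(2) algebra_simps)
        qed
      qed
      with True show ?thesis by (simp add: u_comp)
    qed
    ultimately have "u \<in> subsols l" by (simp add: subsols_def)
    from max_subsol_upper[OF l this, of x i] have "b x \<le> ?w x $ i" by (simp add: u_comp)
    moreover have "b x \<ge> ?w x $ i + \<delta>" using r(1) by (simp add: b_def \<psi>\<^sub>0_def)
    ultimately show False using \<delta>(1) by simp
  qed
qed

subsection \<open>Vanishing discount\<close>

lemma ergodic_solution:
  "\<exists>a v. ergodic_visc_sol F f D (\<chi> i. a) v \<and> (\<exists>L. L-lipschitz_on UNIV v)"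
proof -
  define l where "l n = inverse (real (Suc n))" for n
  have l: "l n > 0" for n by (simp add: l_def)
  define w where "w n = max_subsol (l n)" for n
  have w: "w n \<in> subsols (l n)" for n unfolding w_def by (rule max_subsol_in_subsols[OF l])
  obtain A where A: "A \<ge> 0" "\<And>i x. f i x \<le> A" by (rule f_bounded) blast
  obtain C where C: "C \<ge> 0" "\<And>l u x i j. l > 0 \<Longrightarrow> u \<in> subsols l \<Longrightarrow> u x $ j - u x $ i \<le> C"
    using subsols_oscillation by blast
  obtain L where L: "L > 0" "\<And>l u i. l > 0 \<Longrightarrow> u \<in> subsols l \<Longrightarrow> L-lipschitz_on UNIV (\<lambda>x. u x $ i)"
    using subsols_lipschitz by blast
  obtain i\<^sub>0 :: 'm where True by simp
  \<comment> \<open>All components are shifted by the same number, so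
    \<open>D *v z n x = D *v w n x\<close>.\<close>
  define z where "z n x = w n x - (\<chi> i. w n 0 $ i\<^sub>0)" for n x
  define \<kappa> where "\<kappa> n = l n * w n 0 $ i\<^sub>0" for n
  have z_per: "periodic1 (z n)" for n
    using max_subsol_periodic[OF l, of n] by (simp add: periodic1_def z_def w_def)
  have z_lip1: "L-lipschitz_on UNIV (\<lambda>x. z n x $ i)" for n i
    using L(2)[OF l w, of n i] by (simp add: z_def lipschitz_on_def dist_real_def)
  define K where "K = real CARD('m) * L"
  have z_lip: "K-lipschitz_on UNIV (z n)" for n
    unfolding K_def by (rule lipschitz_on_components) (rule z_lip1)
  have z_cont: "continuous_on UNIV (z n)" for n
    by (rule lipschitz_on_continuous_on[OF z_lip])
  have "bounded (cbox 0 (1::real^'n))" by simp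
  then obtain R where R: "\<And>x::real^'n. x \<in> cbox 0 1 \<Longrightarrow> norm x \<le> R"
    unfolding bounded_iff by blast
  \<comment> \<open>The oscillation bound controls \<open>z n 0\<close>, and the Lipschitz bound
    carries this over the unit cube.\<close>
  define Z where "Z = real CARD('m) * C + K * R"
  have z_bdd: "norm (z n x) \<le> Z" for n x
  proof -
    obtain k where k: "int_vec k" "x + k \<in> cbox 0 1" by (rule periodic_translate_unit_cube)
    have "norm (z n 0) \<le> (\<Sum>i\<in>UNIV. \<bar>z n 0 $ i\<bar>)" by (rule norm_le_l1_cart)
    also have "\<dots> \<le> (\<Sum>i\<in>(UNIV::'m set). C)"
      using C(2)[OF l w, of n] by (intro sum_mono) (simp add: z_def abs_le_iff)
    finally have "norm (z n 0) \<le> real CARD('m) * C" by simp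
    moreover have "norm (z n (x + k) - z n 0) \<le> K * norm (x + k)"
      using lipschitz_onD[OF z_lip, of "x + k" 0 n] by (simp add: dist_norm)
    moreover have "K * norm (x + k) \<le> K * R"
      using R[OF k(2)] L(1) by (intro mult_left_mono) (auto simp: K_def)
    moreover have "z n (x + k) = z n x" using z_per k(1) by (simp add: periodic1_def)
    ultimately show ?thesis
      using norm_triangle_sub[of "z n (x + k)" "z n 0"] by (simp add: Z_def)
  qed
  have "\<bar>\<kappa> n\<bar> \<le> A" for n
  proof -
    have "0 \<le> \<kappa> n" using w[of n] l[of n] by (simp add: \<kappa>_def subsols_def)
    then show ?thesis using subsols_bound[OF w l A(2), of n 0 i\<^sub>0] by (simp add: \<kappa>_def)
  qed
  then have "bounded (range \<kappa>)" by (auto simp: bounded_real)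
  then obtain \<kappa>' r where r: "strict_mono r" "(\<kappa> \<circ> r) \<longlonglongrightarrow> \<kappa>'"
    using bounded_imp_convergent_subsequence by blast
  obtain g k where k: "strict_mono (k :: nat \<Rightarrow> nat)" and
    g: "\<And>e. 0 < e \<Longrightarrow> \<exists>N. \<forall>n x. n \<ge> N \<and> x \<in> cbox 0 1 \<longrightarrow> norm (z (r (k n)) x - g x) < e"
  proof (rule Arzela_Ascoli[of "cbox 0 1" "\<lambda>n. z (r n)" Z])
    show "\<exists>d. 0 < d \<and> (\<forall>n y. y \<in> cbox 0 1 \<and> norm (x - y) < d \<longrightarrow> norm (z (r n) x - z (r n) y) < e)"
      if "0 < e" for x e
    proof (intro exI conjI allI impI)
      have K: "K > 0" using L(1) by (simp add: K_def)
      then show "0 < e / K" using that by simp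
      fix n y assume "y \<in> cbox 0 1 \<and> norm (x - y) < e / K"
      then have "K * norm (x - y) < e" using K by (simp add: field_simps)
      then show "norm (z (r n) x - z (r n) y) < e"
        using lipschitz_onD[OF z_lip, of x y "r n"] by (simp add: dist_norm)
    qed
  qed (use z_bdd in auto)
  define s where "s = r \<circ> k"
  have s: "strict_mono s" unfolding s_def using r(1) k by (rule strict_mono_o)
  have \<kappa>_lim: "(\<lambda>n. \<kappa> (s n)) \<longlonglongrightarrow> \<kappa>'"
    using LIMSEQ_subseq_LIMSEQ[OF r(2) k] by (simp add: s_def o_def)
  have l_lim: "(\<lambda>n. l (s n)) \<longlonglongrightarrow> 0"
    using LIMSEQ_subseq_LIMSEQ[OF LIMSEQ_inverse_real_of_nat s] by (simp add: l_def o_def)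
  have "\<exists>t. int_vec t \<and> x + t \<in> cbox 0 1" for x :: "real^'n"
    by (metis periodic_translate_unit_cube)
  then obtain t :: "real^'n \<Rightarrow> real^'n" where t: "\<And>x. int_vec (t x)" "\<And>x. x + t x \<in> cbox 0 1"
    by metis
  \<comment> \<open>Arzela-Ascoli controls \<open>g\<close> on the unit cube only, so it is read
    there through a chosen integer translation; periodicity of \<open>v\<close> follows from
    uniqueness of limits.\<close>
  define v where "v x = g (x + t x)" for x
  have z_v: "uniform_limit UNIV (\<lambda>n. z (s n)) v sequentially"
  proof (rule uniform_limitI)
    fix e :: real assume "e > 0"
    then obtain N where N: "\<And>n x. n \<ge> N \<Longrightarrow> x \<in> cbox 0 1 \<Longrightarrow> norm (z (r (k n)) x - g x) < e"
      using g by blast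
    have "dist (z (s n) x) (v x) < e" if "n \<ge> N" for n x
      using N[OF that t(2)[of x]] z_per[of "s n"] t(1)[of x]
      by (simp add: s_def v_def periodic1_def dist_norm)
    then show "\<forall>\<^sub>F n in sequentially. \<forall>x\<in>UNIV. dist (z (s n) x) (v x) < e"
      by (auto simp: eventually_sequentially)
  qed
  have v_lim: "(\<lambda>n. z (s n) x) \<longlonglongrightarrow> v x" for x
    by (rule tendsto_uniform_limitI[OF z_v]) simp
  have v_per: "periodic1 v"
    unfolding periodic1_def
  proof (intro allI impI)
    fix x q :: "real^'n" assume "int_vec q"
    then have "(\<lambda>n. z (s n) x) \<longlonglongrightarrow> v (x + q)"
      using v_lim[of "x + q"] z_per by (simp add: periodic1_def)
    then show "v (x + q) = v x" using v_lim[of x] by (rule LIMSEQ_unique)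
  qed
  have v_lip: "K-lipschitz_on UNIV v"
  proof (rule lipschitz_onI)
    fix x y
    show "dist (v x) (v y) \<le> K * dist x y"
      by (rule LIMSEQ_le_const2[OF tendsto_dist[OF v_lim v_lim]])
        (use lipschitz_onD[OF z_lip] in auto)
  qed (use L(1) in \<open>simp add: K_def\<close>)
  have v_cont: "continuous_on UNIV v" by (rule lipschitz_on_continuous_on[OF v_lip])
  \<comment> \<open>Here \<open>l n * w n x $ i = \<kappa> n + l n * z n x $ i\<close>, and the last
    term vanishes uniformly along the subsequence; hence the ergodic constant is
    \<open>- \<kappa>'\<close>.\<close>
  define h where "h n i x = f i x - l n * w n x $ i - (D *v w n x) $ i" for n i x
  have h_lim: "uniform_limit UNIV (\<lambda>n. h (s n) i) (\<lambda>x. - \<kappa>' + f i x - (D *v v x) $ i) sequentially" for i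
  proof -
    have "bounded_linear (\<lambda>y. (D *v y) $ i)"
      using bounded_linear_compose[OF bounded_linear_vec_nth matrix_vector_mul_bounded_linear] .
    from bounded_linear.uniform_limit[OF this z_v]
    have 1: "uniform_limit UNIV (\<lambda>n x. (D *v z (s n) x) $ i) (\<lambda>x. (D *v v x) $ i) sequentially"
      by simp
    have 2: "uniform_limit UNIV (\<lambda>n x. \<kappa> (s n)) (\<lambda>x. \<kappa>') sequentially"
      using \<kappa>_lim by (simp add: uniform_limit_iff tendsto_iff)
    have 3: "uniform_limit UNIV (\<lambda>n x. l (s n) * z (s n) x $ i) (\<lambda>x. 0) sequentially"
    proof (rule uniform_limitI)
      fix e :: real assume "e > 0"
      moreover have Z: "Z \<ge> 0" using z_bdd[of 0 0] norm_ge_zero by (rule order_trans[rotated])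
      ultimately have "\<forall>\<^sub>F n in sequentially. dist (l (s n)) 0 < e / (Z + 1)"
        by (intro tendstoD[OF l_lim]) simp
      then show "\<forall>\<^sub>F n in sequentially. \<forall>x\<in>UNIV. dist (l (s n) * z (s n) x $ i) 0 < e"
      proof eventually_elim
        case (elim n)
        have "dist (l (s n) * z (s n) x $ i) 0 < e" for x
        proof -
          have "\<bar>z (s n) x $ i\<bar> \<le> Z" using component_le_norm_cart z_bdd by (rule order_trans)
          then have "\<bar>l (s n) * z (s n) x $ i\<bar> \<le> l (s n) * (Z + 1)"
            using l[of "s n"] by (simp add: abs_mult)
          also have "\<dots> < e" using elim l[of "s n"] Z by (simp add: field_simps)
          finally show ?thesis by simp
        qed
        then show ?case by simp
      qed
    qed
    have "uniform_limit UNIV (\<lambda>n x. f i x - (\<kappa> (s n) + l (s n) * z (s n) x $ i) - (D *v z (s n) x) $ i)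
        (\<lambda>x. f i x - (\<kappa>' + 0) - (D *v v x) $ i) sequentially"
      by (intro uniform_limit_minus uniform_limit_add uniform_limit_const 1 2 3)
    moreover have "h (s n) i = (\<lambda>x. f i x - (\<kappa> (s n) + l (s n) * z (s n) x $ i) - (D *v z (s n) x) $ i)" for n
      by (simp add: fun_eq_iff h_def z_def \<kappa>_def mult_shift right_diff_distrib)
    moreover have "f i x - (\<kappa>' + 0) - (D *v v x) $ i = - \<kappa>' + f i x - (D *v v x) $ i" for x
      by simp
    ultimately show ?thesis by simp
  qed
  have rhs: "continuous_on UNIV (\<lambda>x. - \<kappa>' + f i x - (D *v v x) $ i)" for i
    using rhs_continuous[OF v_cont, of "- \<kappa>'" i 0] by simp
  have comp: "uniform_limit UNIV (\<lambda>n x. z (s n) x $ i) (\<lambda>x. v x $ i) sequentially"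
    and cont: "continuous_on UNIV (\<lambda>x. z n x $ i)" for i n
    using bounded_linear.uniform_limit[OF bounded_linear_vec_nth z_v]
    by (auto intro!: continuous_intros z_cont)
  have "visc_sub (F i) (\<lambda>x. - \<kappa>' + f i x - (D *v v x) $ i) (\<lambda>x. v x $ i)" for i
  proof (rule visc_sub_uniform_limit[OF F_cont rhs comp h_lim])
    show "visc_sub (F i) (h (s n) i) (\<lambda>x. z (s n) x $ i)" for n
      using w[of "s n"] by (simp add: z_def visc_sub_add_const h_def[abs_def] subsols_def)
  qed (rule cont)
  moreover have "visc_super (F i) (\<lambda>x. - \<kappa>' + f i x - (D *v v x) $ i) (\<lambda>x. v x $ i)" for i
  proof (rule visc_super_uniform_limit[OF F_cont rhs comp h_lim])
    show "visc_super (F i) (h (s n) i) (\<lambda>x. z (s n) x $ i)" for n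
      using perron_solution[OF l, of i "s n"]
      by (simp add: z_def visc_super_add_const h_def[abs_def] w_def)
  qed (rule cont)
  ultimately have "ergodic_visc_sol F f D (\<chi> i. - \<kappa>') v"
    using v_cont v_per by (simp add: ergodic_visc_sol_iff)
  with v_lip show ?thesis by blast
qed

subsection \<open>Uniqueness of the ergodic constant\<close>

text \<open>Stated for arbitrary continuous solutions, so that uniqueness of the constant covers
  every competitor and not only the constructed one.\<close>

lemma ergodic_lipschitz:
  assumes "ergodic_visc_sol F f D c v"
  obtains L where "L > 0" "\<And>i. L-lipschitz_on UNIV (\<lambda>x. v x $ i)"
proof -
  have v: "continuous_on UNIV v" "periodic1 v"
      "\<And>i. visc_sub (F i) (\<lambda>x. c $ i + f i x - (D *v v x) $ i) (\<lambda>x. v x $ i)"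
    using assms by (auto simp: ergodic_visc_sol_iff)
  obtain M where M: "\<And>x. norm (v x) \<le> M" by (rule periodic_bounded[OF v(1,2)]) blast
  have "\<exists>B. \<forall>x. norm (c $ i + f i x - (D *v v x) $ i) \<le> B" for i
  proof -
    have "periodic1 (\<lambda>x. c $ i + f i x - (D *v v x) $ i)"
      using v(2) f_per[of i] by (simp add: periodic1_def)
    moreover have "continuous_on UNIV (\<lambda>x. c $ i + f i x - (D *v v x) $ i)"
      using rhs_continuous[OF v(1), of "c $ i" i 0] by simp
    ultimately obtain B where "\<And>x. norm (c $ i + f i x - (D *v v x) $ i) \<le> B"
      using periodic_bounded[of "\<lambda>x. c $ i + f i x - (D *v v x) $ i"] by blast
    then show ?thesis by blast
  qed
  then obtain B where B: "\<And>i x. norm (c $ i + f i x - (D *v v x) $ i) \<le> B i" by metis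
  define K where "K = (\<Sum>i\<in>UNIV. \<bar>B i\<bar>)"
  have K: "c $ i + f i x - (D *v v x) $ i \<le> K" for i x
  proof -
    have "c $ i + f i x - (D *v v x) $ i \<le> \<bar>B i\<bar>" using B[of i x] by simp
    also have "\<dots> \<le> K" unfolding K_def by (intro member_le_sum) auto
    finally show ?thesis .
  qed
  obtain L where L: "L > 0" "\<And>i x p. norm p \<ge> L \<Longrightarrow> K < F i x p"
    by (rule F_coercive_uniform) blast
  have "L-lipschitz_on UNIV (\<lambda>x. v x $ i)" for i
  proof (rule visc_sub_lipschitz[OF v(3)[of i] _ _ K L(2)])
    show "\<bar>v x $ i\<bar> \<le> M" for x using component_le_norm_cart M by (rule order_trans)
  qed (use L(1) v(1) in \<open>auto intro!: continuous_intros\<close>)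
  with L(1) that show ?thesis by blast
qed

text \<open>Doubling of variables at the pair \<open>x\<close>, \<open>x + h\<close>, so that periodicity confines \<open>x\<close> to the unit
  cube. At a maximum over all components as well, the coupling terms are ordered by
  \<open>mult_mono_at\<close>.\<close>

lemma ergodic_comparison:
  assumes sol: "ergodic_visc_sol F f D (\<chi> i. a) v" "ergodic_visc_sol F f D (\<chi> i. b) w"
  shows "b \<le> a"
proof (rule ccontr)
  assume "\<not> b \<le> a"
  have v: "continuous_on UNIV v" "periodic1 v"
      "\<And>i. visc_sub (F i) (\<lambda>x. a + f i x - (D *v v x) $ i) (\<lambda>x. v x $ i)"
    and w: "continuous_on UNIV w" "periodic1 w"
      "\<And>i. visc_super (F i) (\<lambda>x. b + f i x - (D *v w x) $ i) (\<lambda>x. w x $ i)"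
    using sol by (auto simp: ergodic_visc_sol_iff)
  obtain L where L: "L > 0" "\<And>i. L-lipschitz_on UNIV (\<lambda>x. v x $ i)"
    by (rule ergodic_lipschitz[OF sol(1)]) blast
  obtain M where M: "\<And>x. norm (w x) \<le> M" by (rule periodic_bounded[OF w(1,2)]) blast
  have w_bdd: "\<bar>w x $ i\<bar> \<le> M" for x i using component_le_norm_cart M by (rule order_trans)
  \<comment> \<open>The error from evaluating one equation at \<open>x\<close> and at
    \<open>x + h\<close> with the same gradient. It vanishes for \<open>h = 0\<close>, so
    compactness makes it uniformly small for small \<open>h\<close>.\<close>
  define \<Phi> where "\<Phi> i = (\<lambda>(x, h, p). F i (x + h) p - f i (x + h) - F i x p + f i x)" for i
  have "\<exists>d>0. \<forall>x h p. x \<in> cbox 0 1 \<longrightarrow> norm h \<le> 1 \<longrightarrow> norm p \<le> 2 * L \<longrightarrow> norm h < d \<longrightarrow>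
      \<Phi> i (x, h, p) < b - a" for i
  proof -
    let ?S = "cbox 0 (1::real^'n) \<times> cball (0::real^'n) 1 \<times> cball (0::real^'n) (2 * L)"
    have "continuous_on ?S (\<Phi> i)"
      unfolding \<Phi>_def split_def
      by (intro continuous_on_diff continuous_on_add F_continuous_comp
          continuous_on_compose2[OF f_cont] continuous_intros) auto
    then have "uniformly_continuous_on ?S (\<Phi> i)"
      by (rule compact_uniformly_continuous) (intro compact_Times compact_cbox compact_cball)
    then obtain d where d: "d > 0"
        "\<And>q q'. q \<in> ?S \<Longrightarrow> q' \<in> ?S \<Longrightarrow> dist q' q < d \<Longrightarrow> dist (\<Phi> i q') (\<Phi> i q) < b - a"
      using \<open>\<not> b \<le> a\<close> unfolding uniformly_continuous_on_def
      by (metis diff_gt_0_iff_gt not_le)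
    have "\<Phi> i (x, h, p) < b - a"
      if "x \<in> cbox 0 1" "norm h \<le> 1" "norm p \<le> 2 * L" "norm h < d" for x h p
    proof -
      have "dist (\<Phi> i (x, h, p)) (\<Phi> i (x, 0, p)) < b - a"
        by (rule d(2)) (use that in \<open>auto simp: dist_Pair_Pair dist_norm\<close>)
      then show ?thesis by (simp add: \<Phi>_def dist_real_def)
    qed
    with d(1) show ?thesis by blast
  qed
  then obtain d where d: "\<And>i. d i > 0" "\<And>i x h p. x \<in> cbox 0 1 \<Longrightarrow> norm h \<le> 1 \<Longrightarrow>
      norm p \<le> 2 * L \<Longrightarrow> norm h < d i \<Longrightarrow> \<Phi> i (x, h, p) < b - a"
    by metis
  define \<eta> where "\<eta> = min 1 (Min (range d) / 2)"
  have Min: "Min (range d) > 0" using d(1) by (subst Min_gr_iff) auto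
  have \<eta>: "\<eta> > 0" "\<eta> \<le> 1" unfolding \<eta>_def using Min by linarith+
  have \<eta>_less: "\<eta> < d i" for i
  proof -
    have "\<eta> < Min (range d)" unfolding \<eta>_def using Min by linarith
    also have "\<dots> \<le> d i" by (rule Min_le) auto
    finally show ?thesis .
  qed
  \<comment> \<open>At the maximum \<open>N * norm h \<le> L\<close>: this gives
    \<open>norm h \<le> \<eta>\<close> and keeps the gradient of norm \<open>2 * N * norm h\<close>
    below \<open>2 * L\<close> however small \<open>\<eta>\<close> is.\<close>
  define N where "N = L / \<eta>"
  have N: "N > 0" using L(1) \<eta>(1) by (simp add: N_def)
  define \<Psi> where "\<Psi> i x h = v x $ i - w (x + h) $ i - N * (norm h)\<^sup>2" for i x h
  have "\<exists>x h. x \<in> cbox 0 1 \<and> (\<forall>x' h'. \<Psi> i x' h' \<le> \<Psi> i x h)" for i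
  proof -
    \<comment> \<open>Beyond this radius the penalty exceeds \<open>2 * M\<close>, so
      \<open>h = 0\<close> does at least as well and the search can be confined to a compact
      set.\<close>
    define \<rho> where "\<rho> = 1 + 2 * M / N"
    have M0: "M \<ge> 0" using M[of 0] norm_ge_zero by (rule order_trans[rotated])
    have \<rho>: "\<rho> \<ge> 1" using M0 N by (simp add: \<rho>_def)
    let ?S = "cbox 0 (1::real^'n) \<times> cball (0::real^'n) \<rho>"
    have "continuous_on ?S (\<lambda>q. v (fst q))"
      by (rule continuous_on_compose2[OF v(1)]) (auto intro!: continuous_intros)
    moreover have "continuous_on ?S (\<lambda>q. w (fst q + snd q))"
      by (rule continuous_on_compose2[OF w(1)]) (auto intro!: continuous_intros)
    ultimately have "continuous_on ?S (\<lambda>q. \<Psi> i (fst q) (snd q))"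
      unfolding \<Psi>_def by (intro continuous_intros)
    moreover have "?S \<noteq> {}"
    proof -
      have "(0, 0) \<in> ?S" using \<rho> by (simp add: mem_box_cart)
      then show ?thesis by blast
    qed
    moreover have "compact ?S" by (intro compact_Times compact_cbox compact_cball)
    ultimately obtain q where q: "q \<in> ?S" "\<And>q'. q' \<in> ?S \<Longrightarrow> \<Psi> i (fst q') (snd q') \<le> \<Psi> i (fst q) (snd q)"
      using continuous_attains_sup[of ?S "\<lambda>q. \<Psi> i (fst q) (snd q)"] by blast
    have "\<Psi> i x' h' \<le> \<Psi> i (fst q) (snd q)" for x' h'
    proof -
      obtain k where k: "int_vec k" "x' + k \<in> cbox 0 1" by (rule periodic_translate_unit_cube)
      have shift: "\<Psi> i x' h'' = \<Psi> i (x' + k) h''" for h''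
      proof -
        have "v (x' + k) = v x'" "w (x' + h'' + k) = w (x' + h'')"
          using v(2) w(2) k(1) by (auto simp: periodic1_def)
        then show ?thesis by (simp add: \<Psi>_def add_ac)
      qed
      show ?thesis
      proof (cases "norm h' \<le> \<rho>")
        case True
        then show ?thesis using q(2)[of "(x' + k, h')"] k(2) by (simp add: shift)
      next
        case False
        then have "norm h' * 1 \<le> norm h' * norm h'"
          using \<rho> by (intro mult_left_mono) auto
        moreover have "1 + 2 * M / N \<le> norm h'" using False by (simp add: \<rho>_def)
        ultimately have "N * (2 * M / N) \<le> N * (norm h')\<^sup>2"
          using N unfolding power2_eq_square by (intro mult_left_mono) auto
        then have "\<Psi> i x' h' \<le> \<Psi> i x' 0"
          using w_bdd[of x' i] w_bdd[of "x' + h'" i] N by (simp add: \<Psi>_def abs_le_iff)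
        also have "\<dots> \<le> \<Psi> i (fst q) (snd q)"
          using q(2)[of "(x' + k, 0)"] k(2) \<rho> by (simp add: shift)
        finally show ?thesis .
      qed
    qed
    with q(1) show ?thesis by (intro exI[of _ "fst q"] exI[of _ "snd q"]) auto
  qed
  then obtain X H where X: "\<And>i. X i \<in> cbox 0 1"
      and XH: "\<And>i x' h'. \<Psi> i x' h' \<le> \<Psi> i (X i) (H i)"
    by metis
  obtain i where i: "\<And>j. (\<chi> i. \<Psi> i (X i) (H i)) $ j \<le> (\<chi> i. \<Psi> i (X i) (H i)) $ i"
    by (rule largest_component) blast
  define x where "x = X i"
  define h where "h = H i"
  have max: "\<Psi> j x' h' \<le> \<Psi> i x h" for j x' h'
    using XH[of j x' h'] i[of j] by (simp add: x_def h_def)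
  define y where "y = x + h"
  \<comment> \<open>The common gradient of the two quadratic test functions, for \<open>v\<close> at
    \<open>x\<close> and for \<open>w\<close> at \<open>y\<close>.\<close>
  define p where "p = - (2 * N) *\<^sub>R h"
  have h_small: "norm h \<le> \<eta>"
  proof (cases "h = 0")
    case False
    \<comment> \<open>The competitor \<open>(x + h, 0)\<close> has the same \<open>w\<close> term,
      so only the Lipschitz bound of \<open>v\<close> enters.\<close>
    have "N * (norm h)\<^sup>2 \<le> v x $ i - v (x + h) $ i"
      using max[of i "x + h" 0] by (simp add: \<Psi>_def)
    also have "\<dots> \<le> L * norm h"
      using lipschitz_onD[OF L(2), of x "x + h" i] by (simp add: dist_real_def dist_norm)
    finally have "(N * norm h) * norm h \<le> L * norm h" by (simp add: power2_eq_square mult.assoc)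
    then have "N * norm h \<le> L" using False by simp
    then show ?thesis using L(1) \<eta>(1) by (simp add: N_def field_simps)
  qed (use \<eta> in simp)
  have "N * norm h \<le> N * \<eta>" using h_small N by simp
  also have "N * \<eta> = L" using \<eta>(1) by (simp add: N_def)
  finally have p_small: "norm p \<le> 2 * L" using N by (simp add: p_def)
  have "F i x p \<le> a + f i x - (D *v v x) $ i"
  proof -
    have C1: "C1_with_grad (\<lambda>x'. 0 + N * (dist x' y)\<^sup>2) (\<lambda>x'. (2 * N) *\<^sub>R (x' - y))"
      by (rule C1_with_grad_quadratic)
    have "v x' $ i - (0 + N * (dist x' y)\<^sup>2) \<le> v x $ i - (0 + N * (dist x y)\<^sup>2)" for x'
      using max[of i x' "y - x'"] by (simp add: \<Psi>_def y_def dist_norm norm_minus_commute)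
    then have "loc_max_at (\<lambda>x'. v x' $ i - (0 + N * (dist x' y)\<^sup>2)) x"
      unfolding loc_max_at_def by (intro exI[of _ 1]) auto
    with v(3) C1 have "F i x ((2 * N) *\<^sub>R (x - y)) \<le> a + f i x - (D *v v x) $ i"
      unfolding visc_sub_def by blast
    then show ?thesis by (simp add: p_def y_def)
  qed
  moreover have "b + f i y - (D *v w y) $ i \<le> F i y p"
  proof -
    have C1: "C1_with_grad (\<lambda>y'. 0 + - N * (dist y' x)\<^sup>2) (\<lambda>y'. (2 * - N) *\<^sub>R (y' - x))"
      by (rule C1_with_grad_quadratic)
    have "w y $ i - (0 + - N * (dist y x)\<^sup>2) \<le> w y' $ i - (0 + - N * (dist y' x)\<^sup>2)" for y'
      using max[of i x "y' - x"] by (simp add: \<Psi>_def y_def dist_norm)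
    then have "loc_min_at (\<lambda>y'. w y' $ i - (0 + - N * (dist y' x)\<^sup>2)) y"
      unfolding loc_min_at_def by (intro exI[of _ 1]) auto
    with w(3) C1 have "b + f i y - (D *v w y) $ i \<le> F i y ((2 * - N) *\<^sub>R (y - x))"
      unfolding visc_super_def by blast
    then show ?thesis by (simp add: p_def y_def)
  qed
  moreover have "(D *v w y) $ i \<le> (D *v v x) $ i"
    using max[of _ x h] by (intro mult_mono_at) (simp add: \<Psi>_def y_def)
  moreover have "\<Phi> i (x, h, p) < b - a"
    using d(2)[of x h p i] X[of i] h_small \<eta>(2) \<eta>_less[of i] p_small by (simp add: x_def)
  ultimately show False by (simp add: \<Phi>_def y_def)
qed

subsection \<open>Bounds on the ergodic constant\<close>

lemma weighted_coupling_zero: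
  assumes "transpose D *v \<Lambda> = 0"
  shows "(\<Sum>i\<in>UNIV. \<Lambda> $ i * (D *v z) $ i) = 0"
proof -
  have "(\<Sum>i\<in>UNIV. \<Lambda> $ i * (D *v z) $ i) = \<Lambda> \<bullet> (D *v z)" by (simp add: inner_vec_def)
  also have "\<dots> = (\<Lambda> v* D) \<bullet> z" by (rule dot_lmul_matrix[symmetric])
  also have "\<Lambda> v* D = 0" using assms by simp
  finally show ?thesis by simp
qed

lemma ergodic_upper_bound:
  assumes sol: "ergodic_visc_sol F f D (\<chi> i. a) v"
    and \<Lambda>: "\<And>i. \<Lambda> $ i > 0" "transpose D *v \<Lambda> = 0"
  shows "- a * (\<Sum>i\<in>UNIV. \<Lambda> $ i) \<le> (\<Sum>i\<in>UNIV. \<Lambda> $ i * f i x)"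
proof -
  have v: "continuous_on UNIV v"
      "\<And>i. visc_sub (F i) (\<lambda>x. a + f i x - (D *v v x) $ i) (\<lambda>x. v x $ i)"
    using sol by (auto simp: ergodic_visc_sol_iff)
  have "0 \<le> a + f i x - (D *v v x) $ i" for i
  proof (rule visc_sub_rhs_nonneg[OF v(2)[of i] _ _ F_nonneg])
    show "continuous_on UNIV (\<lambda>x. a + f i x - (D *v v x) $ i)"
      using rhs_continuous[OF v(1), of a i 0] by simp
  qed (use v(1) in \<open>intro continuous_intros\<close>)
  then have "0 \<le> (\<Sum>i\<in>UNIV. \<Lambda> $ i * (a + f i x - (D *v v x) $ i))"
    using \<Lambda>(1) by (intro sum_nonneg mult_nonneg_nonneg) (auto simp: less_imp_le)
  also have "\<dots> = a * (\<Sum>i\<in>UNIV. \<Lambda> $ i) + (\<Sum>i\<in>UNIV. \<Lambda> $ i * f i x)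
      - (\<Sum>i\<in>UNIV. \<Lambda> $ i * (D *v v x) $ i)"
    by (simp add: algebra_simps sum.distrib sum_subtractf sum_distrib_left)
  finally show ?thesis using weighted_coupling_zero[OF \<Lambda>(2), of "v x"] by simp
qed

lemma ergodic_lower_bound:
  assumes sol: "ergodic_visc_sol F f D (\<chi> i. a) v"
    and \<Lambda>: "\<And>i. \<Lambda> $ i > 0" "transpose D *v \<Lambda> = 0"
  shows "(\<Sum>i\<in>UNIV. \<Lambda> $ i * (INF x. f i x)) \<le> - a * (\<Sum>i\<in>UNIV. \<Lambda> $ i)"
proof -
  have v: "continuous_on UNIV v" "periodic1 v"
      "\<And>i. visc_super (F i) (\<lambda>x. a + f i x - (D *v v x) $ i) (\<lambda>x. v x $ i)"
    using sol by (auto simp: ergodic_visc_sol_iff)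
  have "\<exists>x. \<forall>y. v x $ i \<le> v y $ i" for i
  proof -
    have "continuous_on UNIV (\<lambda>x. v x $ i)" using v(1) by (intro continuous_intros)
    moreover have "periodic1 (\<lambda>x. v x $ i)" using v(2) by (simp add: periodic1_def)
    ultimately obtain x where "\<And>y. v x $ i \<le> v y $ i"
      using periodic_attains_inf[of "\<lambda>x. v x $ i"] by blast
    then show ?thesis by blast
  qed
  then obtain X where X: "\<And>i y. v (X i) $ i \<le> v y $ i" by metis
  \<comment> \<open>The minima are attained at different points, but the weighted sum cancels only
    for a single vector. The vector of minima works: it lies below \<open>v (X i)\<close> with
    equality in component \<open>i\<close>, so \<open>mult_mono_at\<close> applies.\<close>
  define z where "z = (\<chi> i. v (X i) $ i)"
  have "(INF x. f i x) \<le> (D *v z) $ i - a" for i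
  proof -
    have "loc_min_at (\<lambda>y. v y $ i - 0) (X i)"
      unfolding loc_min_at_def using X by (intro exI[of _ 1]) auto
    then have "a + f i (X i) - (D *v v (X i)) $ i \<le> F i (X i) 0"
      using v(3) C1_with_grad_const[of 0] unfolding visc_super_def by blast
    moreover have "(D *v v (X i)) $ i \<le> (D *v z) $ i"
      by (rule mult_mono_at) (simp add: z_def X)
    moreover have "(INF x. f i x) \<le> f i (X i)"
      using f_nonneg by (intro cINF_lower bdd_belowI[of _ 0]) auto
    ultimately show ?thesis by (simp add: F_zero)
  qed
  then have "(\<Sum>i\<in>UNIV. \<Lambda> $ i * (INF x. f i x)) \<le> (\<Sum>i\<in>UNIV. \<Lambda> $ i * ((D *v z) $ i - a))"
    using \<Lambda>(1) by (intro sum_mono mult_left_mono) (auto simp: less_imp_le)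
  also have "\<dots> = (\<Sum>i\<in>UNIV. \<Lambda> $ i * (D *v z) $ i) - a * (\<Sum>i\<in>UNIV. \<Lambda> $ i)"
    by (simp add: algebra_simps sum_subtractf sum_distrib_left)
  finally show ?thesis using weighted_coupling_zero[OF \<Lambda>(2), of z] by simp
qed

end

theorem theorem4p4:
  fixes D :: "real^'m^'m"
    and F :: "'m \<Rightarrow> real^'n \<Rightarrow> real^'n \<Rightarrow> real"
    and f :: "'m \<Rightarrow> real^'n \<Rightarrow> real"
  assumes D_diag: "\<And>i. D $ i $ i \<ge> 0"
    and D_off: "\<And>i j. i \<noteq> j \<Longrightarrow> D $ i $ j \<le> 0"
    and D_rows: "\<And>i. (\<Sum>j\<in>UNIV. D $ i $ j) = 0"
    and D_irr: "irreducible_mat D"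
    and H0_F: "\<And>i. continuous_on UNIV (\<lambda>z. F i (fst z) (snd z))"
    and H0_f: "\<And>i. continuous_on UNIV (f i)"
    and H0_Fper: "\<And>i p. periodic1 (\<lambda>x. F i x p)"
    and H0_fper: "\<And>i. periodic1 (f i)"
    and H1_convex: "\<And>i x. convex_on UNIV (F i x)"
    and H1_coercive: "\<And>i M. \<exists>R. \<forall>x p. norm p \<ge> R \<longrightarrow> F i x p \<ge> M"
    and H1_zero: "\<And>i x. F i x 0 = 0"
    and H1_nonneg: "\<And>i x p. F i x p \<ge> 0"
    and H2: "\<And>i x. f i x \<ge> 0"
  shows "\<exists>c. (\<exists>v. ergodic_visc_sol F f D c v \<and> (\<exists>L. L-lipschitz_on UNIV v))
           \<and> D *v c = 0
           \<and> (\<forall>c' v'. ergodic_visc_sol F f D c' v' \<and> D *v c' = 0 \<longrightarrow> c' = c)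
           \<and> (\<forall>i j. c $ i = c $ j)
           \<and> (\<forall>\<Lambda> :: real^'m. (\<forall>i. \<Lambda> $ i > 0) \<and> transpose D *v \<Lambda> = 0 \<longrightarrow>
                (\<forall>i1. (\<Sum>i\<in>UNIV. \<Lambda> $ i * (INF x. f i x)) \<le> - c $ i1 * (\<Sum>i\<in>UNIV. \<Lambda> $ i)
                     \<and> - c $ i1 * (\<Sum>i\<in>UNIV. \<Lambda> $ i) \<le> (INF x. \<Sum>i\<in>UNIV. \<Lambda> $ i * f i x)))"
proof -
  interpret weakly_coupled D F f
    using D_off D_rows D_irr H0_F H0_f H0_Fper H0_fper H1_coercive H1_zero H1_nonneg H2
    by unfold_locales
  obtain a v L where v: "ergodic_visc_sol F f D (\<chi> i. a) v" "L-lipschitz_on UNIV v"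
    using ergodic_solution by blast
  have unique: "c' = (\<chi> i. a)" if "ergodic_visc_sol F f D c' v'" "D *v c' = 0" for c' v'
  proof -
    \<comment> \<open>Any index serves, since a kernel vector has equal components.\<close>
    define b where "b = c' $ undefined"
    have c': "c' = (\<chi> i. b)"
      using kernel_const[OF that(2)] by (simp add: vec_eq_iff b_def)
    with that(1) v(1) have "b = a" by (auto intro: antisym ergodic_comparison)
    with c' show ?thesis by simp
  qed
  show ?thesis
  proof (intro exI[of _ "\<chi> i. a"] conjI allI impI)
    show "\<exists>v. ergodic_visc_sol F f D (\<chi> i. a) v \<and> (\<exists>L. L-lipschitz_on UNIV v)"
      using v by blast
    show "D *v (\<chi> i. a) = 0" by (rule mult_const)
    show "c' = (\<chi> i. a)" if "ergodic_visc_sol F f D c' v' \<and> D *v c' = 0" for c' v'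
      using unique that by blast
  next
    fix \<Lambda> :: "real^'m" and i1 assume \<Lambda>: "(\<forall>i. \<Lambda> $ i > 0) \<and> transpose D *v \<Lambda> = 0"
    show "(\<Sum>i\<in>UNIV. \<Lambda> $ i * (INF x. f i x)) \<le> - (\<chi> i. a) $ i1 * (\<Sum>i\<in>UNIV. \<Lambda> $ i)"
      using ergodic_lower_bound[OF v(1), of \<Lambda>] \<Lambda> by simp
    show "- (\<chi> i. a) $ i1 * (\<Sum>i\<in>UNIV. \<Lambda> $ i) \<le> (INF x. \<Sum>i\<in>UNIV. \<Lambda> $ i * f i x)"
      using ergodic_upper_bound[OF v(1), of \<Lambda>] \<Lambda> by (intro cINF_greatest) auto
  qed simp
qed

end
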